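(* Let $G$ be a Lie group with identity element $e$ and let $\mathcal{A}: G\rightarrow G$ be a smooth pointed averaging operator on $G$, i.e. a smooth map with $\mathcal{A}(e)=e$ and $\mathcal{A}(g)\mathcal{A}(h)\mathcal{A}(g)^{-1} = \mathcal{A}(\mathcal{A}(g)h\mathcal{A}(g)^{-1})$ for all $g,h\in G$. If $\mathfrak{g}=T_eG$ is the Lie algebra of $G$, then the differential $P=\mathcal{A}_{*e}:\mathfrak{g}\rightarrow\mathfrak{g}$ of $\mathcal{A}$ at $e$ is an averaging operator on the Lie algebra $\mathfrak{g}$; in other words, $(\mathfrak{g},P)$ is an averaging Lie algebra.
   Context: An averaging operator on a Lie algebra $(\mathfrak{g},[~,~])$ is a linear map $P:\mathfrak{g}\to\mathfrak{g}$ satisfying $[P(x),P(y)] = P[P(x),y]$ for all $x,y\in\mathfrak{g}$. An averaging Lie algebra is a pair $(\mathfrak{g},P)$ of a Lie algebra $\mathfrak{g}$ and an averaging operator $P$ on it. *)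

theory Defs
  imports "HOL-Analysis.Analysis" "HOL-Algebra.Module"
begin

section \<open>Smooth maps between open subsets of vector spaces\<close>

text \<open>
  The two notions below are meant for open \<open>S\<close> and a finite-dimensional domain. There, continuity of
  \<open>x \<mapsto> Df(x) v\<close> for every \<open>v\<close> is continuity of \<open>Df\<close>, so \<open>Ck_on k S f\<close> says that \<open>f\<close> is of class
  \<open>C\<^sup>k\<close> on \<open>S\<close>.
\<close>

fun Ck_on :: "nat \<Rightarrow> 'v::real_normed_vector set \<Rightarrow> ('v \<Rightarrow> 'w::real_normed_vector) \<Rightarrow> bool" where
  "Ck_on 0 S f \<longleftrightarrow> continuous_on S f"
| "Ck_on (Suc k) S f \<longleftrightarrow>
     (\<forall>x\<in>S. f differentiable (at x)) \<and> (\<forall>v. Ck_on k S (\<lambda>x. frechet_derivative f (at x) v))"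

definition smooth_on :: "'v::real_normed_vector set \<Rightarrow> ('v \<Rightarrow> 'w::real_normed_vector) \<Rightarrow> bool" where
  "smooth_on S f \<longleftrightarrow> (\<forall>k. Ck_on k S f)"


section \<open>Smooth manifolds\<close>

text \<open>
  A manifold is given by a topology, whose \<open>topspace\<close> is the underlying set, and an atlas of charts
  \<open>(U, \<phi>)\<close>, not required to be maximal. Charts take values in a finite-dimensional real inner product
  space \<open>'e\<close>. The class \<open>euclidean_space\<close> is not used because it excludes dimension 0; the
  completeness in the class \<open>banach\<close> is automatic in finite dimension.
\<close>

type_synonym ('a, 'e) chart = "'a set \<times> ('a \<Rightarrow> 'e)"

record ('a, 'e) manifold =
  mtop :: "'a topology"
  atlas :: "('a, 'e) chart set"

definition is_chart :: "'a topology \<Rightarrow> 'a set \<Rightarrow> ('a \<Rightarrow> 'e::topological_space) \<Rightarrow> bool" where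
  "is_chart T U \<phi> \<longleftrightarrow> openin T U \<and> open (\<phi> ` U) \<and>
     homeomorphic_map (subtopology T U) (top_of_set (\<phi> ` U)) \<phi>"

definition smooth_manifold :: "('a, 'e::{real_inner,banach}) manifold \<Rightarrow> bool" where
  "smooth_manifold M \<longleftrightarrow>
     (\<exists>B::'e set. finite B \<and> span B = UNIV) \<and>
     Hausdorff_space (mtop M) \<and> second_countable (mtop M) \<and>
     (\<forall>(U, \<phi>) \<in> atlas M. is_chart (mtop M) U \<phi>) \<and>
     topspace (mtop M) = (\<Union>(U, \<phi>) \<in> atlas M. U) \<and>
     (\<forall>(U, \<phi>) \<in> atlas M. \<forall>(V, \<psi>) \<in> atlas M.
        smooth_on (\<phi> ` (U \<inter> V)) (\<psi> \<circ> inv_into U \<phi>))"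

definition prod_manifold :: "('a, 'e) manifold \<Rightarrow> ('b, 'f) manifold \<Rightarrow> ('a \<times> 'b, 'e \<times> 'f) manifold" where
  "prod_manifold M N =
     \<lparr>mtop = prod_topology (mtop M) (mtop N),
      atlas = {(U \<times> V, map_prod \<phi> \<psi>) | U \<phi> V \<psi>. (U, \<phi>) \<in> atlas M \<and> (V, \<psi>) \<in> atlas N}\<rparr>"

text \<open>Continuity makes the sets \<open>\<phi> ` (U \<inter> F -` V)\<close> open.\<close>

definition smooth_map ::
  "('a, 'e::real_normed_vector) manifold \<Rightarrow> ('b, 'f::real_normed_vector) manifold \<Rightarrow> ('a \<Rightarrow> 'b) \<Rightarrow> bool"
where
  "smooth_map M N F \<longleftrightarrow>
     continuous_map (mtop M) (mtop N) F \<and>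
     (\<forall>(U, \<phi>) \<in> atlas M. \<forall>(V, \<psi>) \<in> atlas N.
        smooth_on (\<phi> ` (U \<inter> F -` V)) (\<psi> \<circ> F \<circ> inv_into U \<phi>))"


section \<open>Tangent spaces and differentials\<close>

definition smooth_near :: "('a, 'e::real_normed_vector) manifold \<Rightarrow> 'a \<Rightarrow> ('a \<Rightarrow> real) \<Rightarrow> bool" where
  "smooth_near M p f \<longleftrightarrow>
     (\<exists>W. openin (mtop M) W \<and> p \<in> W \<and>
        (\<forall>(U, \<phi>) \<in> atlas M. smooth_on (\<phi> ` (U \<inter> W)) (f \<circ> inv_into U \<phi>)))"

definition same_germ :: "('a, 'e) manifold \<Rightarrow> 'a \<Rightarrow> ('a \<Rightarrow> real) \<Rightarrow> ('a \<Rightarrow> real) \<Rightarrow> bool" where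
  "same_germ M p f g \<longleftrightarrow> (\<exists>W. openin (mtop M) W \<and> p \<in> W \<and> (\<forall>x\<in>W. f x = g x))"

text \<open>
  Tangent vectors at \<open>p\<close> are the derivations at \<open>p\<close> of the algebra of germs of smooth functions.
  A derivation takes the value 0 on functions that are not smooth near \<open>p\<close>, so that equality of
  tangent vectors is equality of functions.
\<close>

definition tangent_space :: "('a, 'e::real_normed_vector) manifold \<Rightarrow> 'a \<Rightarrow> (('a \<Rightarrow> real) \<Rightarrow> real) set" where
  "tangent_space M p = {D.
     (\<forall>f. \<not> smooth_near M p f \<longrightarrow> D f = 0) \<and>
     (\<forall>f g. smooth_near M p f \<longrightarrow> smooth_near M p g \<longrightarrow> same_germ M p f g \<longrightarrow> D f = D g) \<and>
     (\<forall>f g. smooth_near M p f \<longrightarrow> smooth_near M p g \<longrightarrow> D (\<lambda>x. f x + g x) = D f + D g) \<and>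
     (\<forall>c f. smooth_near M p f \<longrightarrow> D (\<lambda>x. c * f x) = c * D f) \<and>
     (\<forall>f g. smooth_near M p f \<longrightarrow> smooth_near M p g \<longrightarrow>
        D (\<lambda>x. f x * g x) = D f * g p + f p * D g)}"

text \<open>The differential \<open>F\<^sub>*\<^sub>p\<close>, from the tangent space of \<open>M\<close> at \<open>p\<close> to that of \<open>N\<close> at \<open>F p\<close>.\<close>

definition differential ::
  "('b, 'f::real_normed_vector) manifold \<Rightarrow> ('a \<Rightarrow> 'b) \<Rightarrow> 'a \<Rightarrow>
   (('a \<Rightarrow> real) \<Rightarrow> real) \<Rightarrow> (('b \<Rightarrow> real) \<Rightarrow> real)" where
  "differential N F p D = (\<lambda>f. if smooth_near N (F p) f then D (f \<circ> F) else 0)"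


section \<open>Lie algebras and averaging operators\<close>

text \<open>The multiplication of the record \<open>L\<close> is the Lie bracket; its unit is not used.\<close>

locale lie_algebra = K?: Ring.field K + L?: Module.module K L
  for K (structure) and L (structure) +
  assumes bracket_closed:
      "\<lbrakk>x \<in> carrier L; y \<in> carrier L\<rbrakk> \<Longrightarrow> x \<otimes>\<^bsub>L\<^esub> y \<in> carrier L"
    and bracket_add_left:
      "\<lbrakk>x \<in> carrier L; y \<in> carrier L; z \<in> carrier L\<rbrakk> \<Longrightarrow>
        (x \<oplus>\<^bsub>L\<^esub> y) \<otimes>\<^bsub>L\<^esub> z = x \<otimes>\<^bsub>L\<^esub> z \<oplus>\<^bsub>L\<^esub> y \<otimes>\<^bsub>L\<^esub> z"
    and bracket_add_right:
      "\<lbrakk>x \<in> carrier L; y \<in> carrier L; z \<in> carrier L\<rbrakk> \<Longrightarrow>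
        x \<otimes>\<^bsub>L\<^esub> (y \<oplus>\<^bsub>L\<^esub> z) = x \<otimes>\<^bsub>L\<^esub> y \<oplus>\<^bsub>L\<^esub> x \<otimes>\<^bsub>L\<^esub> z"
    and bracket_smult_left:
      "\<lbrakk>a \<in> carrier K; x \<in> carrier L; y \<in> carrier L\<rbrakk> \<Longrightarrow>
        (a \<odot>\<^bsub>L\<^esub> x) \<otimes>\<^bsub>L\<^esub> y = a \<odot>\<^bsub>L\<^esub> (x \<otimes>\<^bsub>L\<^esub> y)"
    and bracket_smult_right:
      "\<lbrakk>a \<in> carrier K; x \<in> carrier L; y \<in> carrier L\<rbrakk> \<Longrightarrow>
        x \<otimes>\<^bsub>L\<^esub> (a \<odot>\<^bsub>L\<^esub> y) = a \<odot>\<^bsub>L\<^esub> (x \<otimes>\<^bsub>L\<^esub> y)"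
    and bracket_self: "x \<in> carrier L \<Longrightarrow> x \<otimes>\<^bsub>L\<^esub> x = \<zero>\<^bsub>L\<^esub>"
    and jacobi:
      "\<lbrakk>x \<in> carrier L; y \<in> carrier L; z \<in> carrier L\<rbrakk> \<Longrightarrow>
        x \<otimes>\<^bsub>L\<^esub> (y \<otimes>\<^bsub>L\<^esub> z) \<oplus>\<^bsub>L\<^esub> y \<otimes>\<^bsub>L\<^esub> (z \<otimes>\<^bsub>L\<^esub> x) \<oplus>\<^bsub>L\<^esub> z \<otimes>\<^bsub>L\<^esub> (x \<otimes>\<^bsub>L\<^esub> y) = \<zero>\<^bsub>L\<^esub>"

definition linear_operator ::
  "('k, 'm) ring_scheme \<Rightarrow> ('k, 'v, 'n) module_scheme \<Rightarrow> ('v \<Rightarrow> 'v) \<Rightarrow> bool" where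
  "linear_operator K L P \<longleftrightarrow>
     P \<in> carrier L \<rightarrow> carrier L \<and>
     (\<forall>x\<in>carrier L. \<forall>y\<in>carrier L. P (x \<oplus>\<^bsub>L\<^esub> y) = P x \<oplus>\<^bsub>L\<^esub> P y) \<and>
     (\<forall>a\<in>carrier K. \<forall>x\<in>carrier L. P (a \<odot>\<^bsub>L\<^esub> x) = a \<odot>\<^bsub>L\<^esub> P x)"

definition averaging_operator ::
  "('k, 'm) ring_scheme \<Rightarrow> ('k, 'v, 'n) module_scheme \<Rightarrow> ('v \<Rightarrow> 'v) \<Rightarrow> bool" where
  "averaging_operator K L P \<longleftrightarrow>
     linear_operator K L P \<and>
     (\<forall>x\<in>carrier L. \<forall>y\<in>carrier L. P x \<otimes>\<^bsub>L\<^esub> P y = P (P x \<otimes>\<^bsub>L\<^esub> y))"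

definition averaging_lie_algebra ::
  "('k, 'm) ring_scheme \<Rightarrow> ('k, 'v, 'n) module_scheme \<Rightarrow> ('v \<Rightarrow> 'v) \<Rightarrow> bool" where
  "averaging_lie_algebra K L P \<longleftrightarrow> lie_algebra K L \<and> averaging_operator K L P"


section \<open>Lie groups\<close>

definition lie_group :: "('a, 'b) monoid_scheme \<Rightarrow> ('a, 'e::{real_inner,banach}) manifold \<Rightarrow> bool" where
  "lie_group G M \<longleftrightarrow>
     Group.group G \<and> smooth_manifold M \<and> topspace (mtop M) = carrier G \<and>
     smooth_map (prod_manifold M M) M (\<lambda>(x, y). x \<otimes>\<^bsub>G\<^esub> y) \<and>
     smooth_map M M (\<lambda>x. inv\<^bsub>G\<^esub> x)"

text \<open>The value at \<open>x\<close> of the left-invariant vector field whose value at the identity is \<open>D\<close>.\<close>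

definition left_invariant_field ::
  "('a, 'b) monoid_scheme \<Rightarrow> ('a, 'e::real_normed_vector) manifold \<Rightarrow>
   (('a \<Rightarrow> real) \<Rightarrow> real) \<Rightarrow> 'a \<Rightarrow> (('a \<Rightarrow> real) \<Rightarrow> real)" where
  "left_invariant_field G M D x = differential M (\<lambda>y. x \<otimes>\<^bsub>G\<^esub> y) \<one>\<^bsub>G\<^esub> D"

text \<open>The value at the identity of the commutator of the left-invariant vector fields of \<open>D\<close> and \<open>E\<close>.\<close>

definition lie_bracket ::
  "('a, 'b) monoid_scheme \<Rightarrow> ('a, 'e::real_normed_vector) manifold \<Rightarrow>
   (('a \<Rightarrow> real) \<Rightarrow> real) \<Rightarrow> (('a \<Rightarrow> real) \<Rightarrow> real) \<Rightarrow> (('a \<Rightarrow> real) \<Rightarrow> real)" where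
  "lie_bracket G M D E = (\<lambda>f.
     if smooth_near M \<one>\<^bsub>G\<^esub> f
     then D (\<lambda>x. left_invariant_field G M E x f) - E (\<lambda>x. left_invariant_field G M D x f)
     else 0)"

definition real_field :: "real ring" where
  "real_field = \<lparr>carrier = UNIV, mult = (*), one = 1, zero = 0, add = (+)\<rparr>"

definition lie_algebra_of ::
  "('a, 'b) monoid_scheme \<Rightarrow> ('a, 'e::real_normed_vector) manifold \<Rightarrow>
   (real, ('a \<Rightarrow> real) \<Rightarrow> real) module" where
  "lie_algebra_of G M =
     \<lparr>carrier = tangent_space M \<one>\<^bsub>G\<^esub>, mult = lie_bracket G M, one = undefined,
      zero = (\<lambda>f. 0), add = (\<lambda>D E f. D f + E f), smult = (\<lambda>a D f. a * D f)\<rparr>"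

definition smooth_pointed_averaging_operator ::
  "('a, 'b) monoid_scheme \<Rightarrow> ('a, 'e::real_normed_vector) manifold \<Rightarrow> ('a \<Rightarrow> 'a) \<Rightarrow> bool" where
  "smooth_pointed_averaging_operator G M A \<longleftrightarrow>
     smooth_map M M A \<and> A \<one>\<^bsub>G\<^esub> = \<one>\<^bsub>G\<^esub> \<and>
     (\<forall>g\<in>carrier G. \<forall>h\<in>carrier G.
        A g \<otimes>\<^bsub>G\<^esub> A h \<otimes>\<^bsub>G\<^esub> inv\<^bsub>G\<^esub> (A g) = A (A g \<otimes>\<^bsub>G\<^esub> h \<otimes>\<^bsub>G\<^esub> inv\<^bsub>G\<^esub> (A g)))"

end

(*
  Hadamard's lemma, in the form F(x, y) = F(x, q) + sum_i u_i(y) G_i(x, y) with u_i(q) = 0, gives all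
  that is needed about derivations D, E at points of M and N: E F(x, .) is smooth in x, D and E commute
  on functions of two variables, and D F(x, x) = D F(x, p) + D F(p, x). The bracket is therefore
  [D, E] f = D_x E_y f(x y) - E_x D_y f(x y), the commutator for an associative convolution product,
  and also [D, E] f = D_u E_k f(u k u^-1). In the latter form the identity for P is the identity for A
  differentiated in h and then in g at the unit element.
*)

theory Submission
  imports Defs
begin

subsection \<open>Calculus of smooth maps on open sets\<close>

text \<open>\<open>Ck_on\<close> differentiates in fixed directions only, whereas the chain rule
  produces \<open>Df (g x) (Dg x v)\<close>, whose direction moves with x. A Parseval frame, a
  finite B with x = sum of (x . b) b, turns the moving direction into scalar coefficients. It also
  expresses finite dimension, dimension 0 included, and supplies the index set of Hadamard's
  expansion. The coefficients of that expansion are integrals over [0, 1], so their smoothness is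
  differentiation under the integral sign. On manifolds the expansion is effective because in the
  Leibniz rule at q the term that differentiates \<open>G c\<close> carries the factor
  \<open>u c q\<close> = 0. A derivation is 0 on functions that are not smooth. An equation can
  therefore be used under a derivation only as an equality of germs, with smoothness known; hence
  the many neighbourhoods, and later the filter \<open>nhdsin\<close>. Conjugation u k u^-1 fixes k
  = 1 for every u, which keeps all germs at the identity in the averaging argument, whereas the
  product u k moves the base point to u.\<close>

definition parseval_frame :: "'v::real_inner set \<Rightarrow> bool" where
  "parseval_frame B \<longleftrightarrow> finite B \<and> (\<forall>x. (\<Sum>b\<in>B. (x \<bullet> b) *\<^sub>R b) = x)"

lemma parseval_frameD:
  assumes "parseval_frame B"
  shows "finite B" and "(\<Sum>b\<in>B. (x \<bullet> b) *\<^sub>R b) = x"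
  using assms by (auto simp: parseval_frame_def)

text \<open>Gram-Schmidt gives an orthogonal spanning set C; dropping 0 and normalising by
  \<open>sgn\<close> makes it a frame. Both sides of the reproducing formula are linear in x, so it
  is enough to check x in C, where orthogonality leaves a single term.\<close>

lemma parseval_frame_exists:
  fixes B :: "'v::real_inner set"
  assumes "finite B" "span B = UNIV"
  obtains C :: "'v set" where "parseval_frame C"
proof -
  obtain C :: "'v set" where C: "finite C" "span C = UNIV" "pairwise orthogonal C"
    using basis_orthogonal[OF assms(1)] assms(2) by metis
  let ?C = "sgn ` (C - {0})"
  \<comment> \<open>Distinct elements of C are orthogonal, so a common normalisation would be
    orthogonal to itself.\<close>
  have inj: "inj_on sgn (C - {0})"
  proof (rule inj_onI)
    fix x y assume *: "x \<in> C - {0}" "y \<in> C - {0}" "sgn x = sgn y"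
    show "x = y"
    proof (rule ccontr)
      assume "x \<noteq> y"
      then have "x \<bullet> y = 0" using C(3) * by (auto simp: pairwise_def orthogonal_def)
      then have "sgn x \<bullet> sgn y = 0" by (simp add: sgn_div_norm)
      with * have "sgn x = 0" by simp
      with * show False by (simp add: sgn_zero_iff)
    qed
  qed
  have lin: "linear (\<lambda>x::'v. \<Sum>b\<in>?C. (x \<bullet> b) *\<^sub>R b)"
    by (rule linearI) (simp_all add: inner_add_left scaleR_add_left sum.distrib scaleR_sum_right)
  have "(\<Sum>b\<in>?C. (x \<bullet> b) *\<^sub>R b) = x" for x
  proof (rule linear_eq_on[OF lin linear_ident])
    show "x \<in> span C" using C by simp
    fix c assume c: "c \<in> C"
    show "(\<Sum>b\<in>?C. (c \<bullet> b) *\<^sub>R b) = c"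
    proof (cases "c = 0")
      case False
      have "(\<Sum>b\<in>?C. (c \<bullet> b) *\<^sub>R b) = (\<Sum>b\<in>C - {0}. (c \<bullet> sgn b) *\<^sub>R sgn b)"
        by (simp add: sum.reindex[OF inj])
      also have "\<dots> = (\<Sum>b\<in>C - {0}. if b = c then c else 0)"
      proof (rule sum.cong[OF refl])
        fix b assume b: "b \<in> C - {0}"
        show "(c \<bullet> sgn b) *\<^sub>R sgn b = (if b = c then c else 0)"
        proof (cases "b = c")
          case True
          then show ?thesis using False
            by (simp add: sgn_div_norm dot_square_norm power2_eq_square field_simps)
        next
          case False
          then have "c \<bullet> b = 0" using C(3) b c by (auto simp: pairwise_def orthogonal_def)
          then show ?thesis using False by (simp add: sgn_div_norm)
        qed
      qed
      also have "\<dots> = c" using C(1) c False by simp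
      finally show ?thesis .
    qed simp
  qed
  with C(1) have "parseval_frame ?C" by (simp add: parseval_frame_def)
  then show thesis by (rule that)
qed

text \<open>The two frames sit on the two axes. Removing 0 from B keeps the images disjoint, since
  (0, 0) could belong to both, and does not change the sum.\<close>

lemma parseval_frame_prod:
  assumes "parseval_frame B" "parseval_frame C"
  shows "parseval_frame ((\<lambda>b. (b, 0)) ` (B - {0}) \<union> Pair 0 ` C)"
  unfolding parseval_frame_def
proof (intro conjI allI)
  have fin: "finite B" "finite C" using assms by (auto dest: parseval_frameD)
  then show "finite ((\<lambda>b. (b, 0)) ` (B - {0}) \<union> Pair 0 ` C)" by simp
  fix x :: "'a \<times> 'b"
  have "(\<Sum>b\<in>(\<lambda>b. (b, 0)) ` (B - {0}) \<union> Pair 0 ` C. (x \<bullet> b) *\<^sub>R b) =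
    (\<Sum>b\<in>(\<lambda>b. (b, 0)) ` (B - {0}). (x \<bullet> b) *\<^sub>R b) + (\<Sum>b\<in>Pair 0 ` C. (x \<bullet> b) *\<^sub>R b)"
    using fin by (intro sum.union_disjoint) auto
  also have "(\<Sum>b\<in>(\<lambda>b. (b, 0)) ` (B - {0}). (x \<bullet> b) *\<^sub>R b) =
      (\<Sum>b\<in>B - {0}. (x \<bullet> (b, 0)) *\<^sub>R (b, 0))"
    by (subst sum.reindex) (auto simp: inj_on_def)
  also have "\<dots> = (\<Sum>b\<in>B. (x \<bullet> (b, 0)) *\<^sub>R (b, 0))"
    using fin by (intro sum.mono_neutral_left) (auto simp: zero_prod_def)
  also have "\<dots> = (\<Sum>b\<in>B. (fst x \<bullet> b) *\<^sub>R b, 0)"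
    by (simp add: inner_prod_def prod_eq_iff fst_sum snd_sum)
  also have "(\<Sum>b\<in>Pair 0 ` C. (x \<bullet> b) *\<^sub>R b) = (\<Sum>b\<in>C. (x \<bullet> (0, b)) *\<^sub>R (0, b))"
    by (subst sum.reindex) (auto simp: inj_on_def)
  also have "\<dots> = (0, \<Sum>b\<in>C. (snd x \<bullet> b) *\<^sub>R b)"
    by (simp add: inner_prod_def prod_eq_iff fst_sum snd_sum)
  finally show "(\<Sum>b\<in>(\<lambda>b. (b, 0)) ` (B - {0}) \<union> Pair 0 ` C. (x \<bullet> b) *\<^sub>R b) = x"
    using assms by (simp add: parseval_frameD)
qed

lemma linear_parseval_frame:
  assumes "parseval_frame B" "linear L"
  shows "L x = (\<Sum>b\<in>B. (x \<bullet> b) *\<^sub>R L b)"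
proof -
  have "L x = L (\<Sum>b\<in>B. (x \<bullet> b) *\<^sub>R b)" by (simp add: parseval_frameD[OF assms(1)])
  also have "\<dots> = (\<Sum>b\<in>B. (x \<bullet> b) *\<^sub>R L b)"
    using assms(2) by (simp add: linear_sum linear_scale)
  finally show ?thesis .
qed

section \<open>Closure properties of functions of class C^k\<close>

lemma Ck_on_subset:
  assumes "Ck_on k S f" "T \<subseteq> S"
  shows "Ck_on k T f"
  using assms by (induction k arbitrary: f) (auto intro: continuous_on_subset)

lemma Ck_on_SucD:
  assumes "Ck_on (Suc k) S f" "x \<in> S"
  shows "(f has_derivative frechet_derivative f (at x)) (at x)"
  using assms by (simp add: frechet_derivative_works[symmetric])

text \<open>On an open S the derivative at a point depends only on the values in S, so the
  derivatives of f and g agree there and the induction passes to them.\<close>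

lemma Ck_on_cong:
  assumes "Ck_on k S f" "open S" "\<And>x. x \<in> S \<Longrightarrow> f x = g x"
  shows "Ck_on k S g"
  using assms(1,3)
proof (induction k arbitrary: f g)
  case 0
  then show ?case by (simp cong: continuous_on_cong)
next
  case (Suc k)
  have der: "(g has_derivative frechet_derivative f (at x)) (at x)" if "x \<in> S" for x
    using has_derivative_transform_within_open[OF Ck_on_SucD[OF Suc.prems(1) that] assms(2) that]
      Suc.prems(2) by blast
  have eq: "frechet_derivative f (at x) v = frechet_derivative g (at x) v" if "x \<in> S" for x v
    using frechet_derivative_at[OF der[OF that]] by simp
  have "Ck_on k S (\<lambda>x. frechet_derivative g (at x) v)" for v
    by (rule Suc.IH[OF _ eq]) (use Suc.prems(1) in auto)
  with der show ?case by (auto simp: differentiable_def)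
qed

text \<open>Lets the derivative be supplied in any convenient form \<open>f'\<close>; the closure
  rules below take it from the \<open>has_derivative\<close> rules.\<close>

lemma Ck_on_SucI:
  assumes "open S" "\<And>x. x \<in> S \<Longrightarrow> (f has_derivative f' x) (at x)"
    "\<And>v. Ck_on k S (\<lambda>x. f' x v)"
  shows "Ck_on (Suc k) S f"
proof -
  have "Ck_on k S (\<lambda>x. frechet_derivative f (at x) v)" for v
    by (rule Ck_on_cong[OF assms(3)[of v] assms(1)])
      (simp add: frechet_derivative_at[OF assms(2), symmetric])
  with assms(2) show ?thesis by (auto simp: differentiable_def)
qed

lemma Ck_on_Suc_imp:
  assumes "Ck_on (Suc k) S f"
  shows "Ck_on k S f"
  using assms
proof (induction k arbitrary: f)
  case 0
  then show ?case
    by (auto intro!: continuous_at_imp_continuous_on differentiable_imp_continuous_within)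
next
  case (Suc k)
  then show ?case by (metis Ck_on.simps(2))
qed

lemma Ck_on_imp_continuous_on: "Ck_on k S f \<Longrightarrow> continuous_on S f"
  by (induction k) (auto dest: Ck_on_Suc_imp simp del: Ck_on.simps(2))

lemma Ck_on_const: "Ck_on k S (\<lambda>x. c)"
  by (induction k arbitrary: c) (auto simp: frechet_derivative_const)

lemma Ck_on_bounded_linear:
  assumes "bounded_linear L" "Ck_on k S f" "open S"
  shows "Ck_on k S (\<lambda>x. L (f x))"
  using assms(2)
proof (induction k arbitrary: f)
  case 0
  then show ?case by (simp add: bounded_linear.continuous_on[OF assms(1)])
next
  case (Suc k)
  show ?case
    by (rule Ck_on_SucI[OF assms(3) bounded_linear.has_derivative[OF assms(1) Ck_on_SucD[OF Suc.prems]]])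
      (use Suc in auto)
qed

lemma Ck_on_ident: "open S \<Longrightarrow> Ck_on k S (\<lambda>x. x)"
proof (cases k)
  case (Suc j)
  assume "open S"
  then show ?thesis unfolding Suc
    by (rule Ck_on_SucI[OF _ has_derivative_ident]) (rule Ck_on_const)
qed (simp add: continuous_on_id)

lemma Ck_on_add:
  assumes "open S" "Ck_on k S f" "Ck_on k S g"
  shows "Ck_on k S (\<lambda>x. f x + g x)"
  using assms(2,3)
proof (induction k arbitrary: f g)
  case 0
  then show ?case by (simp add: continuous_on_add)
next
  case (Suc k)
  show ?case
    by (rule Ck_on_SucI[OF assms(1) has_derivative_add
          [OF Ck_on_SucD[OF Suc.prems(1)] Ck_on_SucD[OF Suc.prems(2)]]]) (use Suc in auto)
qed

lemma Ck_on_scaleR: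
  fixes f :: "'v::real_normed_vector \<Rightarrow> real" and g :: "'v \<Rightarrow> 'w::real_normed_vector"
  assumes "open S" "Ck_on k S f" "Ck_on k S g"
  shows "Ck_on k S (\<lambda>x. f x *\<^sub>R g x)"
  using assms(2,3)
proof (induction k arbitrary: f g)
  case 0
  then show ?case by (simp add: continuous_on_scaleR)
next
  case (Suc k)
  show ?case
  proof (rule Ck_on_SucI[OF assms(1) has_derivative_scaleR
          [OF Ck_on_SucD[OF Suc.prems(1)] Ck_on_SucD[OF Suc.prems(2)]]])
    fix v
    show "Ck_on k S (\<lambda>x. f x *\<^sub>R frechet_derivative g (at x) v + frechet_derivative f (at x) v *\<^sub>R g x)"
      using Suc.prems by (intro Ck_on_add assms(1) Suc.IH Ck_on_Suc_imp[of k S f] Ck_on_Suc_imp[of k S g]) auto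
  qed
qed

lemma Ck_on_Pair:
  assumes "open S" "Ck_on k S f" "Ck_on k S g"
  shows "Ck_on k S (\<lambda>x. (f x, g x))"
  using assms(2,3)
proof (induction k arbitrary: f g)
  case 0
  then show ?case by (simp add: continuous_on_Pair)
next
  case (Suc k)
  show ?case
    by (rule Ck_on_SucI[OF assms(1) has_derivative_Pair
          [OF Ck_on_SucD[OF Suc.prems(1)] Ck_on_SucD[OF Suc.prems(2)]]]) (use Suc in auto)
qed

lemma Ck_on_sum:
  assumes "open S" "\<And>i. i \<in> I \<Longrightarrow> Ck_on k S (f i)"
  shows "Ck_on k S (\<lambda>x. \<Sum>i\<in>I. f i x)"
  using assms(2)
  by (induction I rule: infinite_finite_induct) (auto intro: Ck_on_const Ck_on_add[OF assms(1)])

text \<open>The derivative in direction v is \<open>?Df (g x) (?Dg x v)\<close>, which is not a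
  fixed function evaluated at g x. Expanding \<open>?Dg x v\<close> in the frame writes it as a sum
  of scalar functions times \<open>?Df (g x) b\<close> with b fixed, and the induction hypothesis
  applies to each map y |-> Df(y) b.\<close>

lemma Ck_on_compose:
  fixes g :: "'v::real_normed_vector \<Rightarrow> 'w::real_inner"
  assumes B: "parseval_frame (B::'w set)" and S: "open S" and T: "open T" and sub: "g ` S \<subseteq> T"
    and g: "Ck_on k S g" and f: "Ck_on k T f"
  shows "Ck_on k S (\<lambda>x. f (g x))"
  using g f
proof (induction k arbitrary: f)
  case 0
  then show ?case using sub by (auto intro: continuous_on_compose2)
next
  case (Suc k)
  let ?Df = "\<lambda>x. frechet_derivative f (at x)" and ?Dg = "\<lambda>x. frechet_derivative g (at x)"
  have Dg: "(g has_derivative ?Dg x) (at x)" if "x \<in> S" for x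
    using Ck_on_SucD[OF Suc.prems(1) that] .
  have Df: "(f has_derivative ?Df (g x)) (at (g x))" if "x \<in> S" for x
    using Ck_on_SucD[OF Suc.prems(2)] that sub by blast
  show ?case
  proof (rule Ck_on_SucI[OF S has_derivative_compose[OF Dg Df]])
    fix v
    have "Ck_on k S (\<lambda>x. \<Sum>b\<in>B. (?Dg x v \<bullet> b) *\<^sub>R ?Df (g x) b)"
      using Suc.prems
      by (intro Ck_on_sum[OF S] Ck_on_scaleR[OF S] Suc.IH[OF Ck_on_Suc_imp[OF Suc.prems(1)]]
          Ck_on_bounded_linear[OF bounded_linear_inner_left _ S]) auto
    then show "Ck_on k S (\<lambda>x. ?Df (g x) (?Dg x v))"
    proof (rule Ck_on_cong[OF _ S])
      fix x assume "x \<in> S"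
      show "(\<Sum>b\<in>B. (?Dg x v \<bullet> b) *\<^sub>R ?Df (g x) b) = ?Df (g x) (?Dg x v)"
        by (rule linear_parseval_frame[OF B, symmetric])
          (rule has_derivative_linear[OF Df[OF \<open>x \<in> S\<close>]])
    qed
  qed
qed

section \<open>The same rules for smooth functions\<close>

lemma smooth_on_subset: "smooth_on S f \<Longrightarrow> T \<subseteq> S \<Longrightarrow> smooth_on T f"
  by (auto simp: smooth_on_def intro: Ck_on_subset)

lemma smooth_on_cong:
  "smooth_on S f \<Longrightarrow> open S \<Longrightarrow> (\<And>x. x \<in> S \<Longrightarrow> f x = g x) \<Longrightarrow> smooth_on S g"
  unfolding smooth_on_def by (blast intro: Ck_on_cong)

lemma smooth_on_const: "smooth_on S (\<lambda>x. c)"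
  by (simp add: smooth_on_def Ck_on_const)

lemma smooth_on_ident: "open S \<Longrightarrow> smooth_on S (\<lambda>x. x)"
  by (simp add: smooth_on_def Ck_on_ident)

lemma smooth_on_bounded_linear:
  "bounded_linear L \<Longrightarrow> smooth_on S f \<Longrightarrow> open S \<Longrightarrow> smooth_on S (\<lambda>x. L (f x))"
  by (simp add: smooth_on_def Ck_on_bounded_linear)

lemma smooth_on_add: "open S \<Longrightarrow> smooth_on S f \<Longrightarrow> smooth_on S g \<Longrightarrow> smooth_on S (\<lambda>x. f x + g x)"
  by (simp add: smooth_on_def Ck_on_add)

lemma smooth_on_scaleR:
  fixes f :: "'v::real_normed_vector \<Rightarrow> real"
  shows "open S \<Longrightarrow> smooth_on S f \<Longrightarrow> smooth_on S g \<Longrightarrow> smooth_on S (\<lambda>x. f x *\<^sub>R g x)"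
  by (simp add: smooth_on_def Ck_on_scaleR)

lemma smooth_on_mult:
  fixes f g :: "'v::real_normed_vector \<Rightarrow> real"
  shows "open S \<Longrightarrow> smooth_on S f \<Longrightarrow> smooth_on S g \<Longrightarrow> smooth_on S (\<lambda>x. f x * g x)"
  using smooth_on_scaleR[of S f g] by simp

lemma smooth_on_Pair:
  "open S \<Longrightarrow> smooth_on S f \<Longrightarrow> smooth_on S g \<Longrightarrow> smooth_on S (\<lambda>x. (f x, g x))"
  by (simp add: smooth_on_def Ck_on_Pair)

lemma smooth_on_sum:
  "open S \<Longrightarrow> (\<And>i. i \<in> I \<Longrightarrow> smooth_on S (f i)) \<Longrightarrow> smooth_on S (\<lambda>x. \<Sum>i\<in>I. f i x)"
  by (simp add: smooth_on_def Ck_on_sum)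

lemma smooth_on_compose:
  fixes g :: "'v::real_normed_vector \<Rightarrow> 'w::real_inner"
  assumes "parseval_frame (B::'w set)" "open S" "open T" "g ` S \<subseteq> T" "smooth_on S g" "smooth_on T f"
  shows "smooth_on S (\<lambda>x. f (g x))"
  using assms(5,6) unfolding smooth_on_def by (blast intro: Ck_on_compose[OF assms(1-4)])

lemma smooth_on_imp_continuous_on: "smooth_on S f \<Longrightarrow> continuous_on S f"
  by (metis smooth_on_def Ck_on.simps(1))

lemma smooth_on_has_derivative:
  "smooth_on S f \<Longrightarrow> x \<in> S \<Longrightarrow> (f has_derivative frechet_derivative f (at x)) (at x)"
  by (metis smooth_on_def Ck_on_SucD)

lemma smooth_on_frechet_derivative:
  "smooth_on S f \<Longrightarrow> smooth_on S (\<lambda>x. frechet_derivative f (at x) v)"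
  by (metis smooth_on_def Ck_on.simps(2))

text \<open>Differentiation under the integral sign: the derivative in direction v is the integral
  of \<open>?D (x, t) (v, 0)\<close>, again a parameter integral, with an integrand one class lower.
  The open set T around S x [0, 1] gives differentiability up to the endpoints of the
  interval.\<close>

lemma Ck_on_parametric_integral:
  fixes H :: "'v::{real_inner,banach} \<times> real \<Rightarrow> real"
  assumes B: "parseval_frame (B::'v set)" and S: "open S" and T: "open T" and sub: "S \<times> {0..1} \<subseteq> T"
    and H: "Ck_on k T H"
  shows "Ck_on k S (\<lambda>x. integral {0..1} (\<lambda>t. H (x, t)))"
  using H
proof (induction k arbitrary: H)
  case 0
  then have "continuous_on (S \<times> cbox 0 1) (\<lambda>(x, t). H (x, t))"
    using sub continuous_on_subset by (fastforce simp: case_prod_beta)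
  from integral_continuous_on_param[OF this] show ?case by simp
next
  case (Suc k)
  let ?D = "\<lambda>z. frechet_derivative H (at z)"
  \<comment> \<open>The x-derivative as a bounded linear map. \<open>leibniz_rule\<close> asks for
    continuity in operator norm, which in this frame form follows from continuity of finitely many
    scalar coefficients.\<close>
  let ?d = "\<lambda>x t. \<Sum>b\<in>B. ?D (x, t) (b, 0) *\<^sub>R blinfun_inner_left b"
  have conth: "continuous_on T H"
    using Suc.prems by (rule Ck_on_imp_continuous_on)
  have contd: "continuous_on T (\<lambda>z. ?D z v)" for v
    by (rule Ck_on_imp_continuous_on[of k]) (use Suc.prems in \<open>simp only: Ck_on.simps\<close>)
  have dapp: "blinfun_apply (?d x t) v = ?D (x, t) (v, 0)" if "(x, t) \<in> T" for x t v
  proof -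
    have "linear (\<lambda>v. ?D (x, t) (v, 0))"
      using bounded_linear.linear[OF bounded_linear_compose
          [OF has_derivative_bounded_linear[OF Ck_on_SucD[OF Suc.prems that]]
            bounded_linear_Pair[OF bounded_linear_ident bounded_linear_zero]]] .
    from linear_parseval_frame[OF B this, of v] show ?thesis
      by (simp add: blinfun.sum_left blinfun.scaleR_left mult.commute)
  qed
  have "((\<lambda>x. integral {0..1} (\<lambda>t. H (x, t))) has_derivative
      (\<lambda>v. integral {0..1} (\<lambda>t. ?D (x, t) (v, 0)))) (at x)" if x: "x \<in> S" for x
  proof -
    \<comment> \<open>\<open>leibniz_rule\<close> is applied on a ball because a ball is convex; as
      the ball is open, the derivative within it is the derivative at x.\<close>
    obtain r where r: "r > 0" "ball x r \<subseteq> S" using S x openE by blast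
    have inT: "(y, t) \<in> T" if "y \<in> ball x r" "t \<in> {0..1}" for y t using that r sub by blast
    have contd': "continuous_on (ball x r \<times> cbox 0 1) (\<lambda>(x, t). ?d x t)"
    proof -
      have "ball x r \<times> cbox 0 1 \<subseteq> T" using inT by auto
      then have "continuous_on (ball x r \<times> cbox 0 1)
          (\<lambda>z. \<Sum>b\<in>B. ?D z (b, 0) *\<^sub>R blinfun_inner_left b)"
        by (intro continuous_on_sum continuous_on_scaleR continuous_on_const
            continuous_on_subset[OF contd])
      then show ?thesis by (simp add: case_prod_beta)
    qed
    have leib: "((\<lambda>x. integral (cbox 0 1) (\<lambda>t. H (x, t))) has_derivative
       blinfun_apply (integral (cbox 0 1) (?d x))) (at x within ball x r)"
    proof (rule leibniz_rule)
      fix y t assume yt: "y \<in> ball x r" "t \<in> cbox (0::real) 1"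
      then have T: "(y, t) \<in> T" using inT by simp
      have "((\<lambda>x. (x, t)) has_derivative (\<lambda>v. (v, 0))) (at y)"
        by (auto intro!: derivative_eq_intros)
      from has_derivative_compose[OF this Ck_on_SucD[OF Suc.prems T]]
      have "((\<lambda>x. H (x, t)) has_derivative (\<lambda>v. ?D (y, t) (v, 0))) (at y within ball x r)"
        by (rule has_derivative_at_withinI)
      moreover have "(\<lambda>v. ?D (y, t) (v, 0)) = blinfun_apply (?d y t)"
        by (rule ext) (rule dapp[OF T, symmetric])
      ultimately show "((\<lambda>x. H (x, t)) has_derivative blinfun_apply (?d y t)) (at y within ball x r)"
        by (rule has_derivative_eq_rhs)
    next
      fix y assume y: "y \<in> ball x r"
      show "(\<lambda>t. H (y, t)) integrable_on cbox 0 1"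
        using inT y by (intro integrable_continuous continuous_on_compose2[OF conth]
            continuous_on_Pair continuous_on_const continuous_on_id) auto
    qed (use contd' r in auto)
    have "blinfun_apply (integral {0..1} (?d x)) v = integral {0..1} (\<lambda>t. ?D (x, t) (v, 0))" for v
    proof -
      have "continuous_on {0..1} (?d x)"
      proof -
        have c1: "continuous_on {0..1} (Pair x :: real \<Rightarrow> _)" by (intro continuous_intros)
        have c2: "Pair x ` {0..1} \<subseteq> ball x r \<times> cbox (0::real) 1" using r by auto
        show ?thesis
          using continuous_on_compose2[OF contd' c1 c2] by (simp only: prod.case)
      qed
      then have "?d x integrable_on {0..1}" by (rule integrable_continuous_real)
      from integral_linear[OF this blinfun.bounded_linear_left[of v]]
      have "blinfun_apply (integral {0..1} (?d x)) v = integral {0..1} (\<lambda>t. blinfun_apply (?d x t) v)"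
        by (simp add: o_def)
      also have "\<dots> = integral {0..1} (\<lambda>t. ?D (x, t) (v, 0))"
        using inT[of x] r by (intro integral_cong) (simp add: dapp)
      finally show ?thesis .
    qed
    then have "blinfun_apply (integral (cbox 0 1) (?d x)) = (\<lambda>v. integral {0..1} (\<lambda>t. ?D (x, t) (v, 0)))"
      by (intro ext) (simp only: box_real)
    from has_derivative_eq_rhs[OF leib this] show ?thesis
      unfolding box_real using r(1) by (simp only: at_within_open[OF _ open_ball] centre_in_ball)
  qed
  then show ?case
    by (rule Ck_on_SucI[OF S]) (use Suc in auto)
qed

lemma smooth_on_parametric_integral:
  fixes H :: "'v::{real_inner,banach} \<times> real \<Rightarrow> real"
  assumes "parseval_frame (B::'v set)" "open S" "open T" "S \<times> {0..1} \<subseteq> T" "smooth_on T H"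
  shows "smooth_on S (\<lambda>x. integral {0..1} (\<lambda>t. H (x, t)))"
  using Ck_on_parametric_integral[OF assms(1-4)] assms(5) by (simp add: smooth_on_def)

text \<open>F(x, y) - F(x, b) is the integral over t in [0, 1] of the derivative of t |-> F(x, b + t
  (y - b)). That derivative is linear in y - b, so the frame C splits the integral into factors (y -
  b) . c times the integrals \<open>G c\<close>.\<close>

lemma smooth_on_Hadamard:
  fixes F :: "'v::{real_inner,banach} \<times> 'w::{real_inner,banach} \<Rightarrow> real"
  assumes B: "parseval_frame (B::'v set)" and C: "parseval_frame (C::'w set)"
    and F: "smooth_on T F" and T: "open T" "(a, b) \<in> T"
  obtains r G where "r > 0" "ball a r \<times> ball b r \<subseteq> T"
    "\<And>c. smooth_on (ball a r \<times> ball b r) (G c)"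
    "\<And>x y. x \<in> ball a r \<Longrightarrow> y \<in> ball b r \<Longrightarrow>
      F (x, y) = F (x, b) + (\<Sum>c\<in>C. ((y - b) \<bullet> c) * G c (x, y))"
proof -
  let ?DF = "\<lambda>z. frechet_derivative F (at z)"
  \<comment> \<open>The segment map ((x, y), t) |-> (x, b + t (y - b)). It is smooth everywhere, so
    the preimage of T is an open set on which the integrand is smooth. The form \<open>+ -\<close>
    fits the addition rule.\<close>
  define \<sigma> :: "('v \<times> 'w) \<times> real \<Rightarrow> 'v \<times> 'w"
    where "\<sigma> = (\<lambda>u. (fst (fst u), b + snd u *\<^sub>R (snd (fst u) + - b)))"
  define G where "G = (\<lambda>c z. integral {0..1} (\<lambda>t. ?DF (\<sigma> (z, t)) (0, c)))"
  note P = parseval_frame_prod[OF B C]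
  obtain U V where UV: "open U" "open V" "a \<in> U" "b \<in> V" "U \<times> V \<subseteq> T"
    using open_prod_elim[OF T] by (metis mem_Sigma_iff)
  then obtain r1 r2 where r12: "r1 > 0" "ball a r1 \<subseteq> U" "r2 > 0" "ball b r2 \<subseteq> V"
    by (metis openE)
  \<comment> \<open>One radius for both balls; the ball around b contains the segment from b to each
    of its points.\<close>
  define r where "r = min r1 r2"
  have r: "r > 0" using r12 by (simp add: r_def)
  have "ball a r \<subseteq> U" "ball b r \<subseteq> V" using r12 by (auto simp: r_def)
  then have r2: "ball a r \<times> ball b r \<subseteq> T" using UV(5) by blast
  have fst2: "bounded_linear (\<lambda>u::('v \<times> 'w) \<times> real. fst (fst u))"
    and snd2: "bounded_linear (\<lambda>u::('v \<times> 'w) \<times> real. snd (fst u))"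
    using bounded_linear_compose[OF bounded_linear_fst bounded_linear_fst]
      bounded_linear_compose[OF bounded_linear_snd bounded_linear_fst] by blast+
  have \<sigma>_UNIV: "smooth_on UNIV \<sigma>"
    unfolding \<sigma>_def
    by (intro smooth_on_Pair smooth_on_add smooth_on_scaleR smooth_on_const open_UNIV
        smooth_on_bounded_linear[OF fst2] smooth_on_bounded_linear[OF snd2]
        smooth_on_bounded_linear[OF bounded_linear_snd] smooth_on_ident)
  have \<sigma>: "smooth_on (\<sigma> -` T) \<sigma>" "open (\<sigma> -` T)"
    using smooth_on_subset[OF \<sigma>_UNIV subset_UNIV]
      open_vimage[OF T(1) smooth_on_imp_continuous_on[OF \<sigma>_UNIV]] by simp_all
  have seg: "b + t *\<^sub>R (y + - b) \<in> ball b r" if "y \<in> ball b r" "t \<in> {0..1}" for y and t :: real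
  proof -
    have "norm (t *\<^sub>R (y + - b)) \<le> norm (y + - b)"
      using that by (simp add: mult_left_le_one_le)
    then show ?thesis using that by (simp add: dist_norm norm_minus_commute)
  qed
  have "\<sigma> ((x, y), t) \<in> T" if "x \<in> ball a r" "y \<in> ball b r" "t \<in> {0..1}" for x y t
    using seg[OF that(2,3)] that(1) r2 unfolding \<sigma>_def fst_conv snd_conv by blast
  then have in\<sigma>: "(ball a r \<times> ball b r) \<times> {0..1} \<subseteq> \<sigma> -` T"
    by blast
  have "smooth_on (ball a r \<times> ball b r) (G c)" for c
    unfolding G_def
    by (rule smooth_on_parametric_integral[OF P _ \<sigma>(2) in\<sigma>],
        simp add: open_Times, rule smooth_on_compose[OF P \<sigma>(2) T(1) _ \<sigma>(1)],
        auto intro: smooth_on_frechet_derivative[OF F])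
  moreover have "F (x, y) = F (x, b) + (\<Sum>c\<in>C. ((y - b) \<bullet> c) * G c (x, y))"
    if xy: "x \<in> ball a r" "y \<in> ball b r" for x y
  proof -
    have inT: "(x, b + t *\<^sub>R (y - b)) \<in> T" if "t \<in> {0..1}" for t
      using seg[OF xy(2) that] xy r2 by auto
    have der: "((\<lambda>t. F (x, b + t *\<^sub>R (y - b))) has_vector_derivative
        (\<Sum>c\<in>C. ((y - b) \<bullet> c) * ?DF (x, b + t *\<^sub>R (y - b)) (0, c))) (at t within {0..1})"
      if t: "t \<in> {0..1}" for t
    proof -
      let ?L = "?DF (x, b + t *\<^sub>R (y - b))"
      have DF: "(F has_derivative ?L) (at (x, b + t *\<^sub>R (y - b)))"
        using smooth_on_has_derivative[OF F inT[OF t]] .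
      have "((\<lambda>t. (x, b + t *\<^sub>R (y - b))) has_derivative (\<lambda>h. (0, h *\<^sub>R (y - b)))) (at t)"
        by (intro has_derivative_Pair has_derivative_const) (auto intro!: derivative_eq_intros)
      from has_derivative_compose[OF this DF]
      have "((\<lambda>t. F (x, b + t *\<^sub>R (y - b))) has_derivative (\<lambda>h. ?L (0, h *\<^sub>R (y - b)))) (at t within {0..1})"
        by (rule has_derivative_at_withinI)
      moreover have "?L (0, h *\<^sub>R (y - b)) = h *\<^sub>R (\<Sum>c\<in>C. ((y - b) \<bullet> c) * ?L (0, c))" for h
      proof -
        have "linear (\<lambda>v. ?L (0, v))"
          using bounded_linear.linear[OF bounded_linear_compose[OF has_derivative_bounded_linear[OF DF]
                bounded_linear_Pair[OF bounded_linear_zero bounded_linear_ident]]] .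
        from linear_parseval_frame[OF C this, of "y - b"] linear_scale[OF this, of h "y - b"]
        show ?thesis by (simp only: real_scaleR_def scaleR_Pair scale_zero_right)
      qed
      then have "(\<lambda>h. ?L (0, h *\<^sub>R (y - b))) = (\<lambda>h. h *\<^sub>R (\<Sum>c\<in>C. ((y - b) \<bullet> c) * ?L (0, c)))"
        by (rule ext)
      ultimately show ?thesis
        unfolding has_vector_derivative_def by (rule has_derivative_eq_rhs)
    qed
    have "((\<lambda>t. ((y - b) \<bullet> c) * ?DF (\<sigma> ((x, y), t)) (0, c)) has_integral ((y - b) \<bullet> c) * G c (x, y)) {0..1}" for c
    proof -
      have "smooth_on (\<sigma> -` T) (\<lambda>u. ?DF (\<sigma> u) (0, c))"
        by (rule smooth_on_compose[OF P \<sigma>(2) T(1) _ \<sigma>(1)]) (auto intro: smooth_on_frechet_derivative[OF F])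
      note sm = smooth_on_imp_continuous_on[OF this]
      have c1: "continuous_on {0..1} (\<lambda>t::real. ((x, y), t))" by (intro continuous_intros)
      have c2: "(\<lambda>t. ((x, y), t)) ` {0..1} \<subseteq> \<sigma> -` T" using in\<sigma> xy by blast
      show ?thesis
        unfolding G_def
        by (rule has_integral_mult_right[OF integrable_integral[OF
                integrable_continuous_real[OF continuous_on_compose2[OF sm c1 c2]]]])
    qed
    then have "((\<lambda>t. \<Sum>c\<in>C. ((y - b) \<bullet> c) * ?DF (\<sigma> ((x, y), t)) (0, c)) has_integral
        (\<Sum>c\<in>C. ((y - b) \<bullet> c) * G c (x, y))) {0..1}"
      by (intro has_integral_sum parseval_frameD(1)[OF C])
    moreover have "((\<lambda>t. \<Sum>c\<in>C. ((y - b) \<bullet> c) * ?DF (\<sigma> ((x, y), t)) (0, c)) has_integral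
        F (x, b + 1 *\<^sub>R (y - b)) - F (x, b + 0 *\<^sub>R (y - b))) {0..1}"
      using fundamental_theorem_of_calculus[OF zero_le_one der] by (simp only: \<sigma>_def fst_conv snd_conv diff_conv_add_uminus)
    ultimately have "(\<Sum>c\<in>C. ((y - b) \<bullet> c) * G c (x, y)) = F (x, b + 1 *\<^sub>R (y - b)) - F (x, b + 0 *\<^sub>R (y - b))"
      by (rule has_integral_unique)
    then have "(\<Sum>c\<in>C. ((y - b) \<bullet> c) * G c (x, y)) = F (x, y) - F (x, b)"
      by simp
    then show ?thesis by simp
  qed
  ultimately show thesis using r r2 that by blast
qed

subsection \<open>Smoothness near a point of a manifold\<close>

text \<open>The local part of \<open>smooth_manifold\<close>, with the spanning set replaced by a
  frame. This is the predicate shown below to pass to products, so that every lemma about it applies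
  to product manifolds too.\<close>

definition smooth_atlas :: "('a, 'e::{real_inner,banach}) manifold \<Rightarrow> bool" where
  "smooth_atlas M \<longleftrightarrow>
     (\<exists>B::'e set. parseval_frame B) \<and>
     (\<forall>(U, \<phi>) \<in> atlas M. is_chart (mtop M) U \<phi>) \<and>
     topspace (mtop M) = (\<Union>(U, \<phi>) \<in> atlas M. U) \<and>
     (\<forall>(U, \<phi>) \<in> atlas M. \<forall>(V, \<psi>) \<in> atlas M.
        smooth_on (\<phi> ` (U \<inter> V)) (\<psi> \<circ> inv_into U \<phi>))"

lemma smooth_manifold_imp_smooth_atlas: "smooth_manifold M \<Longrightarrow> smooth_atlas M"
  unfolding smooth_manifold_def smooth_atlas_def
  by (elim conjE exE, intro conjI) (erule (1) parseval_frame_exists, blast, assumption+)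

lemma smooth_atlas_frame:
  fixes M :: "('a, 'e::{real_inner,banach}) manifold"
  assumes "smooth_atlas M"
  obtains B :: "'e set" where "parseval_frame B"
  using assms by (auto simp: smooth_atlas_def)

lemma smooth_atlas_chart_at:
  assumes "smooth_atlas M" "p \<in> topspace (mtop M)"
  obtains U \<phi> where "(U, \<phi>) \<in> atlas M" "p \<in> U"
  using assms by (auto simp: smooth_atlas_def)

lemma smooth_atlas_transition:
  assumes "smooth_atlas M" "(U, \<phi>) \<in> atlas M" "(V, \<psi>) \<in> atlas M"
  shows "smooth_on (\<phi> ` (U \<inter> V)) (\<lambda>z. \<psi> (inv_into U \<phi> z))"
  using assms unfolding smooth_atlas_def o_def by fast

section \<open>Charts and smoothness read in a single chart\<close>

lemma is_chart_inj_on: "is_chart T U \<phi> \<Longrightarrow> inj_on \<phi> U"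
  unfolding is_chart_def using homeomorphic_imp_injective_map openin_subset
  by (metis inf.absorb_iff2 topspace_subtopology)

lemma is_chart_image_open:
  assumes "is_chart T U \<phi>" "openin T W"
  shows "open (\<phi> ` (U \<inter> W))"
proof -
  have "openin (subtopology T U) (U \<inter> W)"
    using assms(2) by (auto simp: openin_subtopology)
  then have "openin (top_of_set (\<phi> ` U)) (\<phi> ` (U \<inter> W))"
    using assms(1) homeomorphic_imp_open_map unfolding is_chart_def open_map_def by blast
  then show ?thesis
    using assms(1) openin_open_trans unfolding is_chart_def by blast
qed

lemma is_chart_preimage_open:
  assumes "is_chart T U \<phi>" "open S"
  shows "openin T (U \<inter> \<phi> -` S)"
proof -
  have U: "openin T U" and h: "continuous_map (subtopology T U) (top_of_set (\<phi> ` U)) \<phi>"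
    using assms(1) homeomorphic_imp_continuous_map by (auto simp: is_chart_def)
  have "continuous_map (subtopology T U) euclidean \<phi>"
    using h by (rule continuous_map_into_fulltopology)
  then have "openin (subtopology T U) {x \<in> topspace (subtopology T U). \<phi> x \<in> S}"
    using assms(2) by (intro openin_continuous_map_preimage) auto
  moreover have "{x \<in> topspace (subtopology T U). \<phi> x \<in> S} = U \<inter> \<phi> -` S"
    using openin_subset[OF U] by auto
  ultimately show ?thesis using openin_trans_full U by metis
qed

lemma smooth_atlas_chart:
  assumes "smooth_atlas M" "(U, \<phi>) \<in> atlas M"
  shows "is_chart (mtop M) U \<phi>" "openin (mtop M) U" "open (\<phi> ` U)"
    "\<And>x. x \<in> U \<Longrightarrow> inv_into U \<phi> (\<phi> x) = x"
    "\<And>W. openin (mtop M) W \<Longrightarrow> open (\<phi> ` (U \<inter> W))"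
    "\<And>S. open S \<Longrightarrow> openin (mtop M) (U \<inter> \<phi> -` S)"
proof -
  show ch: "is_chart (mtop M) U \<phi>" using assms by (auto simp: smooth_atlas_def)
  then show "openin (mtop M) U" "open (\<phi> ` U)" by (auto simp: is_chart_def)
  show "inv_into U \<phi> (\<phi> x) = x" if "x \<in> U" for x
    using is_chart_inj_on[OF ch] that by simp
  show "open (\<phi> ` (U \<inter> W))" if "openin (mtop M) W" for W
    using is_chart_image_open[OF ch that] .
  show "openin (mtop M) (U \<inter> \<phi> -` S)" if "open S" for S
    using is_chart_preimage_open[OF ch that] .
qed

text \<open>\<open>smooth_near\<close> speaks of all charts; the transition maps let one chart at p
  decide, since in a chart \<psi> the function reads h o \<phi> o \<psi>^-1. A representative h on
  an open set of coordinates is the form to which the calculus rules apply.\<close>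

lemma smooth_near_iff_chart:
  assumes M: "smooth_atlas M" and U: "(U, \<phi>) \<in> atlas M" and p: "p \<in> U"
  shows "smooth_near M p f \<longleftrightarrow>
    (\<exists>S h. open S \<and> \<phi> p \<in> S \<and> S \<subseteq> \<phi> ` U \<and> smooth_on S h \<and> (\<forall>x\<in>U. \<phi> x \<in> S \<longrightarrow> f x = h (\<phi> x)))"
    (is "_ \<longleftrightarrow> ?R")
proof
  note c = smooth_atlas_chart[OF M U]
  assume "smooth_near M p f"
  then obtain W where W: "openin (mtop M) W" "p \<in> W"
    "smooth_on (\<phi> ` (U \<inter> W)) (f \<circ> inv_into U \<phi>)"
    using U unfolding smooth_near_def by blast
  show ?R
    using W p c(4) c(5)[OF W(1)]
    by (intro exI[of _ "\<phi> ` (U \<inter> W)"] exI[of _ "f \<circ> inv_into U \<phi>"]) auto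
next
  note c = smooth_atlas_chart[OF M U]
  assume ?R
  then obtain S h where S: "open S" "\<phi> p \<in> S" "S \<subseteq> \<phi> ` U" "smooth_on S h"
    "\<And>x. x \<in> U \<Longrightarrow> \<phi> x \<in> S \<Longrightarrow> f x = h (\<phi> x)"
    by blast
  obtain B :: "'b set" where B: "parseval_frame B" using smooth_atlas_frame[OF M] .
  let ?W = "U \<inter> \<phi> -` S"
  have W: "openin (mtop M) ?W" using c(6)[OF S(1)] .
  have "smooth_on (\<psi> ` (V \<inter> ?W)) (f \<circ> inv_into V \<psi>)" if V: "(V, \<psi>) \<in> atlas M" for V \<psi>
  proof (rule smooth_on_cong)
    note d = smooth_atlas_chart[OF M V]
    show op: "open (\<psi> ` (V \<inter> ?W))" using d(5)[OF W] .
    have sm: "smooth_on (\<psi> ` (V \<inter> ?W)) (\<lambda>z. \<phi> (inv_into V \<psi> z))"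
      using smooth_atlas_transition[OF M V U] by (rule smooth_on_subset) auto
    have "(\<lambda>z. \<phi> (inv_into V \<psi> z)) ` \<psi> ` (V \<inter> ?W) \<subseteq> S"
      using d(4) by auto
    then show "smooth_on (\<psi> ` (V \<inter> ?W)) (\<lambda>z. h (\<phi> (inv_into V \<psi> z)))"
      by (rule smooth_on_compose[OF B op S(1) _ sm S(4)])
    show "h (\<phi> (inv_into V \<psi> z)) = (f \<circ> inv_into V \<psi>) z" if "z \<in> \<psi> ` (V \<inter> ?W)" for z
      using that d(4) S(5) by auto
  qed
  then show "smooth_near M p f"
    unfolding smooth_near_def using W p S(2) by (intro exI[of _ ?W]) auto
qed

lemma smooth_near_chartI:
  assumes "smooth_atlas M" "(U, \<phi>) \<in> atlas M" "p \<in> U" "open S" "\<phi> p \<in> S" "S \<subseteq> \<phi> ` U" "smooth_on S h"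
    "\<And>x. x \<in> U \<Longrightarrow> \<phi> x \<in> S \<Longrightarrow> f x = h (\<phi> x)"
  shows "smooth_near M p f"
  unfolding smooth_near_iff_chart[OF assms(1-3)]
  by (rule exI[of _ S], rule exI[of _ h]) (simp add: assms(4-))

lemma smooth_near_chartE:
  assumes "smooth_near M p f" "smooth_atlas M" "(U, \<phi>) \<in> atlas M" "p \<in> U"
  obtains S h where "open S" "\<phi> p \<in> S" "S \<subseteq> \<phi> ` U" "smooth_on S h"
    "\<And>x. x \<in> U \<Longrightarrow> \<phi> x \<in> S \<Longrightarrow> f x = h (\<phi> x)"
  using assms(1) unfolding smooth_near_iff_chart[OF assms(2-4)] by (elim exE conjE) (rule that, assumption+, blast)

lemma smooth_near_topspace: "smooth_near M p f \<Longrightarrow> p \<in> topspace (mtop M)"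
  unfolding smooth_near_def using openin_subset by blast

lemma smooth_near_nhd:
  assumes "smooth_near M p f"
  obtains W where "openin (mtop M) W" "p \<in> W" "\<And>x. x \<in> W \<Longrightarrow> smooth_near M x f"
proof -
  obtain W where W: "openin (mtop M) W" "p \<in> W"
    "\<forall>(U, \<phi>) \<in> atlas M. smooth_on (\<phi> ` (U \<inter> W)) (f \<circ> inv_into U \<phi>)"
    using assms unfolding smooth_near_def by (elim exE conjE)
  show thesis
    by (rule that[OF W(1,2)], unfold smooth_near_def, rule exI[of _ W], intro conjI W)
qed

text \<open>Smoothness near p depends on the germ alone: the coordinate domain S is shrunk to the
  image of W.\<close>

lemma smooth_near_cong:
  assumes M: "smooth_atlas M" and f: "smooth_near M p f"
    and W: "openin (mtop M) W" "p \<in> W" "\<And>x. x \<in> W \<Longrightarrow> f x = g x"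
  shows "smooth_near M p g"
proof -
  obtain U \<phi> where U: "(U, \<phi>) \<in> atlas M" "p \<in> U"
    using smooth_atlas_chart_at[OF M smooth_near_topspace[OF f]] .
  note c = smooth_atlas_chart[OF M U(1)]
  obtain S h where S: "open S" "\<phi> p \<in> S" "S \<subseteq> \<phi> ` U" "smooth_on S h"
    "\<And>x. x \<in> U \<Longrightarrow> \<phi> x \<in> S \<Longrightarrow> f x = h (\<phi> x)"
    using smooth_near_chartE[OF f M U] by blast
  show ?thesis
  proof (rule smooth_near_chartI[OF M U])
    show "open (S \<inter> \<phi> ` (U \<inter> W))" using S(1) c(5)[OF W(1)] by blast
    show "smooth_on (S \<inter> \<phi> ` (U \<inter> W)) h" using S(4) by (rule smooth_on_subset) simp
    fix x assume x: "x \<in> U" "\<phi> x \<in> S \<inter> \<phi> ` (U \<inter> W)"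
    then have "x \<in> W" using c(4) by (metis IntD1 IntD2 imageE)
    then show "g x = h (\<phi> x)" using W(3) S(5) x by force
  qed (use S U W in auto)
qed

lemma smooth_near_const:
  assumes M: "smooth_atlas M" and p: "p \<in> topspace (mtop M)"
  shows "smooth_near M p (\<lambda>x. c)"
proof -
  obtain U \<phi> where U: "(U, \<phi>) \<in> atlas M" "p \<in> U"
    using smooth_atlas_chart_at[OF M p] .
  show ?thesis
    by (rule smooth_near_chartI[OF M U smooth_atlas_chart(3)[OF M U(1)] _ _ smooth_on_const])
      (use U in auto)
qed

lemma smooth_near_add_mult:
  assumes M: "smooth_atlas M" and f: "smooth_near M p f" and g: "smooth_near M p g"
  shows "smooth_near M p (\<lambda>x. f x + g x)" "smooth_near M p (\<lambda>x. f x * g x)"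
proof -
  obtain U \<phi> where U: "(U, \<phi>) \<in> atlas M" "p \<in> U"
    using smooth_atlas_chart_at[OF M smooth_near_topspace[OF f]] .
  obtain S h where S: "open S" "\<phi> p \<in> S" "S \<subseteq> \<phi> ` U" "smooth_on S h"
    "\<And>x. x \<in> U \<Longrightarrow> \<phi> x \<in> S \<Longrightarrow> f x = h (\<phi> x)"
    using smooth_near_chartE[OF f M U] by blast
  obtain T k where T: "open T" "\<phi> p \<in> T" "T \<subseteq> \<phi> ` U" "smooth_on T k"
    "\<And>x. x \<in> U \<Longrightarrow> \<phi> x \<in> T \<Longrightarrow> g x = k (\<phi> x)"
    using smooth_near_chartE[OF g M U] by blast
  have sm: "open (S \<inter> T)" "smooth_on (S \<inter> T) h" "smooth_on (S \<inter> T) k"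
    using S T smooth_on_subset by (blast, metis inf_le1, metis inf_le2)
  have in_ST: "\<phi> p \<in> S \<inter> T" "S \<inter> T \<subseteq> \<phi> ` U" using S T by auto
  show "smooth_near M p (\<lambda>x. f x + g x)"
    by (rule smooth_near_chartI[OF M U sm(1) in_ST smooth_on_add[OF sm]]) (use S T in auto)
  show "smooth_near M p (\<lambda>x. f x * g x)"
    by (rule smooth_near_chartI[OF M U sm(1) in_ST smooth_on_mult[OF sm]]) (use S T in auto)
qed

lemma smooth_near_cmult:
  assumes "smooth_atlas M" "smooth_near M p f"
  shows "smooth_near M p (\<lambda>x. c * f x)"
  by (intro smooth_near_add_mult(2) smooth_near_const assms smooth_near_topspace[OF assms(2)])

lemma smooth_near_diff:
  assumes "smooth_atlas M" "smooth_near M p f" "smooth_near M p g"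
  shows "smooth_near M p (\<lambda>x. f x - g x)"
  using smooth_near_add_mult(1)[OF assms(1,2) smooth_near_cmult[OF assms(1,3), of "- 1"]] by simp

lemma smooth_near_sum:
  assumes "smooth_atlas M" "p \<in> topspace (mtop M)" "\<And>i. i \<in> I \<Longrightarrow> smooth_near M p (f i)"
  shows "smooth_near M p (\<lambda>x. \<Sum>i\<in>I. f i x)"
  using assms(3)
  by (induction I rule: infinite_finite_induct)
    (simp_all add: smooth_near_const[OF assms(1,2)] smooth_near_add_mult(1)[OF assms(1)])

subsection \<open>Smoothness of maps at a point\<close>

text \<open>Smoothness as pulling smooth germs back to smooth germs. Composition becomes immediate,
  and this is exactly what a derivation applied to f o F requires.\<close>

definition smooth_at ::
  "('a, 'e::real_normed_vector) manifold \<Rightarrow> ('b, 'f::real_normed_vector) manifold \<Rightarrow> 'a \<Rightarrow> ('a \<Rightarrow> 'b) \<Rightarrow> bool"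
where
  "smooth_at M N p F \<longleftrightarrow> (\<forall>f. smooth_near N (F p) f \<longrightarrow> smooth_near M p (\<lambda>x. f (F x)))"

lemma smooth_atD: "smooth_at M N p F \<Longrightarrow> smooth_near N (F p) f \<Longrightarrow> smooth_near M p (\<lambda>x. f (F x))"
  by (simp add: smooth_at_def)

lemma smooth_at_compose:
  "smooth_at M N p F \<Longrightarrow> smooth_at N L (F p) H \<Longrightarrow> smooth_at M L p (\<lambda>x. H (F x))"
  unfolding smooth_at_def by (intro allI impI) (drule spec, drule (1) mp, drule spec, drule (1) mp)

lemma smooth_at_ident: "smooth_at M M p (\<lambda>x. x)"
  by (simp add: smooth_at_def)

lemma smooth_at_const:
  "smooth_atlas M \<Longrightarrow> p \<in> topspace (mtop M) \<Longrightarrow> smooth_at M N p (\<lambda>x. c)"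
  by (simp add: smooth_at_def smooth_near_const)

text \<open>Continuity comes for free: indicator functions of neighbourhoods of \<open>F p\<close> are smooth near \<open>F p\<close>.\<close>

lemma smooth_at_nhd:
  assumes M: "smooth_atlas M" and N: "smooth_atlas N" and F: "smooth_at M N p F"
    and V: "openin (mtop N) V" "F p \<in> V"
  obtains W where "openin (mtop M) W" "p \<in> W" "F ` W \<subseteq> V"
proof -
  have Fp: "F p \<in> topspace (mtop N)" using V openin_subset by blast
  have "smooth_near N (F p) (indicat_real V)"
    by (rule smooth_near_cong[OF N smooth_near_const[OF N Fp, of 1] V]) simp
  then have sm: "smooth_near M p (\<lambda>x. indicat_real V (F x))" by (rule smooth_atD[OF F])
  obtain U \<phi> where U: "(U, \<phi>) \<in> atlas M" "p \<in> U"
    using smooth_atlas_chart_at[OF M smooth_near_topspace[OF sm]] .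
  obtain S h where S: "open S" "\<phi> p \<in> S" "S \<subseteq> \<phi> ` U" "smooth_on S h"
    "\<And>x. x \<in> U \<Longrightarrow> \<phi> x \<in> S \<Longrightarrow> indicat_real V (F x) = h (\<phi> x)"
    using smooth_near_chartE[OF sm M U] by blast
  have "open (S \<inter> h -` {0<..})"
    using continuous_open_preimage[OF smooth_on_imp_continuous_on[OF S(4)] S(1)] by simp
  then have "openin (mtop M) (U \<inter> \<phi> -` (S \<inter> h -` {0<..}))"
    by (rule smooth_atlas_chart(6)[OF M U(1)])
  moreover have "p \<in> U \<inter> \<phi> -` (S \<inter> h -` {0<..})"
    using U(2) S(2) S(5)[OF U(2) S(2)] V(2) by simp
  moreover have "F ` (U \<inter> \<phi> -` (S \<inter> h -` {0<..})) \<subseteq> V"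
  proof (rule image_subsetI)
    fix x assume x: "x \<in> U \<inter> \<phi> -` (S \<inter> h -` {0<..})"
    then have "indicat_real V (F x) > 0" using S(5)[of x] by simp
    then show "F x \<in> V" by (simp add: indicator_def split: if_splits)
  qed
  ultimately show thesis by (rule that)
qed

text \<open>Recovers a coordinate expression from the pullback property. The finitely many functions
  y |-> \<psi> y . b are smooth near F p, so their pullbacks have representatives
  \<open>h b\<close>, which the frame reassembles. The neighbourhood W keeps F x inside V, where
  \<psi> is a chart.\<close>

lemma smooth_at_chartE:
  fixes N :: "('b, 'f::{real_inner,banach}) manifold"
  assumes M: "smooth_atlas M" and N: "smooth_atlas N" and F: "smooth_at M N p F"
    and U: "(U, \<phi>) \<in> atlas M" "p \<in> U" and V: "(V, \<psi>) \<in> atlas N" "F p \<in> V"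
  obtains S g where "open S" "\<phi> p \<in> S" "S \<subseteq> \<phi> ` U" "smooth_on S g"
    "\<And>x. x \<in> U \<Longrightarrow> \<phi> x \<in> S \<Longrightarrow> F x \<in> V \<and> \<psi> (F x) = g (\<phi> x)"
proof -
  obtain B :: "'f set" where B: "parseval_frame B" using smooth_atlas_frame[OF N] .
  have "smooth_near M p (\<lambda>x. \<psi> (F x) \<bullet> b)" for b
  proof (rule smooth_atD[OF F])
    show "smooth_near N (F p) (\<lambda>y. \<psi> y \<bullet> b)"
      by (rule smooth_near_chartI[OF N V smooth_atlas_chart(3)[OF N V(1)] _ _
            smooth_on_bounded_linear[OF bounded_linear_inner_left smooth_on_ident]])
        (use V smooth_atlas_chart(3)[OF N V(1)] in auto)
  qed
  from smooth_near_chartE[OF this M U]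
  have "\<exists>S h. open S \<and> \<phi> p \<in> S \<and> S \<subseteq> \<phi> ` U \<and> smooth_on S h \<and>
      (\<forall>x\<in>U. \<phi> x \<in> S \<longrightarrow> \<psi> (F x) \<bullet> b = h (\<phi> x))" for b
    by metis
  then obtain S h where S: "\<And>b. open (S b)" "\<And>b. \<phi> p \<in> S b" "\<And>b. S b \<subseteq> \<phi> ` U"
      "\<And>b. smooth_on (S b) (h b)" "\<And>b x. x \<in> U \<Longrightarrow> \<phi> x \<in> S b \<Longrightarrow> \<psi> (F x) \<bullet> b = h b (\<phi> x)"
    by metis
  obtain W where W: "openin (mtop M) W" "p \<in> W" "F ` W \<subseteq> V"
    using smooth_at_nhd[OF M N F smooth_atlas_chart(2)[OF N V(1)] V(2)] .
  note c = smooth_atlas_chart[OF M U(1)]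
  let ?S = "\<phi> ` (U \<inter> W) \<inter> (\<Inter>b\<in>B. S b)"
  have op: "open ?S"
    using c(5)[OF W(1)] S(1) parseval_frameD(1)[OF B] by (intro open_Int open_INT) auto
  show thesis
  proof (rule that[OF op, of "\<lambda>z. \<Sum>b\<in>B. h b z *\<^sub>R b"])
    show "smooth_on ?S (\<lambda>z. \<Sum>b\<in>B. h b z *\<^sub>R b)"
      by (intro smooth_on_sum op smooth_on_scaleR smooth_on_const smooth_on_subset[OF S(4)]) auto
    fix x assume x: "x \<in> U" "\<phi> x \<in> ?S"
    then have "x \<in> W" using c(4) by (metis IntD1 IntD2 imageE)
    moreover have "(\<Sum>b\<in>B. h b (\<phi> x) *\<^sub>R b) = (\<Sum>b\<in>B. (\<psi> (F x) \<bullet> b) *\<^sub>R b)"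
      using x S(5) by (intro sum.cong) auto
    ultimately show "F x \<in> V \<and> \<psi> (F x) = (\<Sum>b\<in>B. h b (\<phi> x) *\<^sub>R b)"
      using W(3) parseval_frameD(2)[OF B] by auto
  qed (use U W S in auto)
qed

text \<open>Continuity of F makes the domain \<open>?R\<close> of the coordinate expression
  \<open>?k\<close> open; there f o F reads h o \<open>?k\<close>.\<close>

lemma smooth_map_imp_smooth_at:
  fixes N :: "('b, 'f::{real_inner,banach}) manifold"
  assumes M: "smooth_atlas M" and N: "smooth_atlas N" and F: "smooth_map M N F"
    and p: "p \<in> topspace (mtop M)"
  shows "smooth_at M N p F"
  unfolding smooth_at_def
proof (intro allI impI)
  fix f assume f: "smooth_near N (F p) f"
  obtain B :: "'f set" where B: "parseval_frame B" using smooth_atlas_frame[OF N] .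
  obtain U \<phi> where U: "(U, \<phi>) \<in> atlas M" "p \<in> U" using smooth_atlas_chart_at[OF M p] .
  obtain V \<psi> where V: "(V, \<psi>) \<in> atlas N" "F p \<in> V"
    using smooth_atlas_chart_at[OF N smooth_near_topspace[OF f]] .
  obtain T h where T: "open T" "\<psi> (F p) \<in> T" "T \<subseteq> \<psi> ` V" "smooth_on T h"
    "\<And>x. x \<in> V \<Longrightarrow> \<psi> x \<in> T \<Longrightarrow> f x = h (\<psi> x)"
    using smooth_near_chartE[OF f N V] by blast
  note c = smooth_atlas_chart[OF M U(1)]
  let ?k = "\<lambda>z. \<psi> (F (inv_into U \<phi> z))" and ?R = "\<phi> ` (U \<inter> F -` V)"
  have k: "smooth_on ?R ?k"
    using F U(1) V(1) unfolding smooth_map_def o_def by fast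
  have "openin (mtop M) {x \<in> topspace (mtop M). F x \<in> V}"
    using F smooth_atlas_chart(2)[OF N V(1)]
    by (auto simp: smooth_map_def intro: openin_continuous_map_preimage)
  moreover have "U \<inter> {x \<in> topspace (mtop M). F x \<in> V} = U \<inter> F -` V"
    using openin_subset[OF c(2)] by auto
  ultimately have "open ?R" using c(5) by metis
  then have op: "open (?R \<inter> ?k -` T)"
    using continuous_open_preimage[OF smooth_on_imp_continuous_on[OF k]] T(1) by blast
  have "smooth_on (?R \<inter> ?k -` T) (\<lambda>z. h (?k z))"
    by (rule smooth_on_compose[OF B op T(1) _ smooth_on_subset[OF k] T(4)]) auto
  then show "smooth_near M p (\<lambda>x. f (F x))"
  proof (rule smooth_near_chartI[OF M U op, rotated 2])
    fix x assume x: "x \<in> U" "\<phi> x \<in> ?R \<inter> ?k -` T"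
    then obtain y where y: "y \<in> U" "F y \<in> V" "\<phi> x = \<phi> y" by auto
    then have "x = y" using c(4) x(1) by metis
    then show "f (F x) = h (\<psi> (F (inv_into U \<phi> (\<phi> x))))"
      using T(5)[of "F x"] x y c(4)[OF x(1)] by auto
  qed (use U V T c(4) in auto)
qed

subsection \<open>Product manifolds\<close>

lemma mtop_prod_manifold [simp]: "mtop (prod_manifold M N) = prod_topology (mtop M) (mtop N)"
  by (simp add: prod_manifold_def)

lemma atlas_prod_manifold:
  "(W, \<kappa>) \<in> atlas (prod_manifold M N) \<longleftrightarrow>
    (\<exists>U \<phi> V \<psi>. W = U \<times> V \<and> \<kappa> = map_prod \<phi> \<psi> \<and> (U, \<phi>) \<in> atlas M \<and> (V, \<psi>) \<in> atlas N)"
  by (auto simp: prod_manifold_def)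

lemma prod_manifold_chart:
  "(U, \<phi>) \<in> atlas M \<Longrightarrow> (V, \<psi>) \<in> atlas N \<Longrightarrow> (U \<times> V, map_prod \<phi> \<psi>) \<in> atlas (prod_manifold M N)"
  unfolding atlas_prod_manifold by blast

lemma is_chart_prod:
  assumes "is_chart S U \<phi>" "is_chart T V \<psi>"
  shows "is_chart (prod_topology S T) (U \<times> V) (map_prod \<phi> \<psi>)"
proof -
  obtain \<phi>' where "homeomorphic_maps (subtopology S U) (top_of_set (\<phi> ` U)) \<phi> \<phi>'"
    using assms(1) by (auto simp: is_chart_def homeomorphic_map_maps)
  moreover obtain \<psi>' where "homeomorphic_maps (subtopology T V) (top_of_set (\<psi> ` V)) \<psi> \<psi>'"
    using assms(2) by (auto simp: is_chart_def homeomorphic_map_maps)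
  ultimately have "homeomorphic_maps (subtopology (prod_topology S T) (U \<times> V)) (top_of_set (\<phi> ` U \<times> \<psi> ` V))
      (\<lambda>(x, y). (\<phi> x, \<psi> y)) (\<lambda>(x, y). (\<phi>' x, \<psi>' y))"
    unfolding subtopology_Times prod_topology_subtopology_eu[symmetric] homeomorphic_maps_prod by simp
  then have "homeomorphic_map (subtopology (prod_topology S T) (U \<times> V)) (top_of_set (\<phi> ` U \<times> \<psi> ` V))
      (map_prod \<phi> \<psi>)"
    unfolding map_prod_def using homeomorphic_maps_imp_map by blast
  moreover have "map_prod \<phi> \<psi> ` (U \<times> V) = \<phi> ` U \<times> \<psi> ` V" by (rule map_prod_surj_on) simp_all
  ultimately show ?thesis
    using assms by (simp add: is_chart_def openin_prod_Times_iff open_Times)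
qed

lemma smooth_on_fst_snd:
  fixes f :: "'v::real_inner \<Rightarrow> 'c::real_normed_vector" and g :: "'w::real_inner \<Rightarrow> 'd::real_normed_vector"
  assumes "open S" "open T"
  shows "parseval_frame (B::'v set) \<Longrightarrow> smooth_on S f \<Longrightarrow> smooth_on (S \<times> T) (\<lambda>z. f (fst z))"
    and "parseval_frame (C::'w set) \<Longrightarrow> smooth_on T g \<Longrightarrow> smooth_on (S \<times> T) (\<lambda>z. g (snd z))"
proof -
  have op: "open (S \<times> T)" using assms by (rule open_Times)
  have 1: "fst ` (S \<times> T) \<subseteq> S" and 2: "snd ` (S \<times> T) \<subseteq> T" by auto
  show "smooth_on (S \<times> T) (\<lambda>z. f (fst z))" if "parseval_frame B" "smooth_on S f"
    by (rule smooth_on_compose[OF that(1) op assms(1) 1 _ that(2)])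
      (rule smooth_on_bounded_linear[OF bounded_linear_fst smooth_on_ident[OF op] op])
  show "smooth_on (S \<times> T) (\<lambda>z. g (snd z))" if "parseval_frame C" "smooth_on T g"
    by (rule smooth_on_compose[OF that(1) op assms(2) 2 _ that(2)])
      (rule smooth_on_bounded_linear[OF bounded_linear_snd smooth_on_ident[OF op] op])
qed

lemma smooth_atlas_prod:
  fixes M :: "('a, 'e::{real_inner,banach}) manifold" and N :: "('b, 'f::{real_inner,banach}) manifold"
  assumes M: "smooth_atlas M" and N: "smooth_atlas N"
  shows "smooth_atlas (prod_manifold M N)"
proof -
  obtain B :: "'e set" where B: "parseval_frame B" using smooth_atlas_frame[OF M] .
  obtain C :: "'f set" where C: "parseval_frame C" using smooth_atlas_frame[OF N] .
  have frame: "\<exists>B::('e \<times> 'f) set. parseval_frame B" using parseval_frame_prod[OF B C] by blast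
  have charts: "is_chart (mtop (prod_manifold M N)) W \<kappa>" if "(W, \<kappa>) \<in> atlas (prod_manifold M N)" for W \<kappa>
    using that smooth_atlas_chart(1)[OF M] smooth_atlas_chart(1)[OF N]
    by (auto simp: atlas_prod_manifold intro: is_chart_prod)
  have "topspace (mtop (prod_manifold M N)) = (\<Union>(U, \<phi>)\<in>atlas M. U) \<times> (\<Union>(V, \<psi>)\<in>atlas N. V)"
    using M N by (simp add: smooth_atlas_def)
  also have "\<dots> = (\<Union>(W, \<kappa>)\<in>atlas (prod_manifold M N). W)"
  proof (intro equalityI subsetI)
    fix z assume "z \<in> (\<Union>(U, \<phi>)\<in>atlas M. U) \<times> (\<Union>(V, \<psi>)\<in>atlas N. V)"
    then obtain U \<phi> V \<psi> where "(U, \<phi>) \<in> atlas M" "(V, \<psi>) \<in> atlas N" "z \<in> U \<times> V" by auto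
    then show "z \<in> (\<Union>(W, \<kappa>)\<in>atlas (prod_manifold M N). W)"
      using prod_manifold_chart by (intro UN_I[of "(U \<times> V, map_prod \<phi> \<psi>)"]) auto
  next
    fix z assume "z \<in> (\<Union>(W, \<kappa>)\<in>atlas (prod_manifold M N). W)"
    then show "z \<in> (\<Union>(U, \<phi>)\<in>atlas M. U) \<times> (\<Union>(V, \<psi>)\<in>atlas N. V)"
      by (auto simp: atlas_prod_manifold)
  qed
  finally have cover: "topspace (mtop (prod_manifold M N)) = (\<Union>(W, \<kappa>)\<in>atlas (prod_manifold M N). W)" .
  have trans: "smooth_on (\<kappa> ` (W \<inter> W')) (\<kappa>' \<circ> inv_into W \<kappa>)"
    if W: "(W, \<kappa>) \<in> atlas (prod_manifold M N)" and W': "(W', \<kappa>') \<in> atlas (prod_manifold M N)" for W \<kappa> W' \<kappa>'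
  proof -
    obtain U \<phi> V \<psi> where w: "W = U \<times> V" "\<kappa> = map_prod \<phi> \<psi>" and U: "(U, \<phi>) \<in> atlas M" and V: "(V, \<psi>) \<in> atlas N"
      using W by (auto simp: atlas_prod_manifold)
    obtain U' \<phi>' V' \<psi>' where w': "W' = U' \<times> V'" "\<kappa>' = map_prod \<phi>' \<psi>'"
      and U': "(U', \<phi>') \<in> atlas M" and V': "(V', \<psi>') \<in> atlas N"
      using W' by (auto simp: atlas_prod_manifold)
    let ?S = "\<phi> ` (U \<inter> U')" and ?T = "\<psi> ` (V \<inter> V')"
    have S: "open ?S" using smooth_atlas_chart(5)[OF M U smooth_atlas_chart(2)[OF M U']] .
    have T: "open ?T" using smooth_atlas_chart(5)[OF N V smooth_atlas_chart(2)[OF N V']] .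
    have im: "\<kappa> ` (W \<inter> W') = ?S \<times> ?T"
      unfolding w w' Times_Int_Times by (rule map_prod_surj_on) simp_all
    have "smooth_on (?S \<times> ?T) (\<lambda>z. (\<phi>' (inv_into U \<phi> (fst z)), \<psi>' (inv_into V \<psi> (snd z))))"
      by (intro smooth_on_Pair open_Times S T smooth_on_fst_snd(1)[OF S T B smooth_atlas_transition[OF M U U']]
          smooth_on_fst_snd(2)[OF S T C smooth_atlas_transition[OF N V V']])
    then show ?thesis unfolding im
    proof (rule smooth_on_cong[OF _ open_Times[OF S T]])
      fix z assume "z \<in> ?S \<times> ?T"
      then obtain x y where xy: "x \<in> U" "y \<in> V" "z = (\<phi> x, \<psi> y)" by auto
      then have z: "z = \<kappa> (x, y)" "(x, y) \<in> W" by (auto simp: w)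
      have "inv_into W \<kappa> z = (x, y)"
        unfolding z(1) by (rule inv_into_f_f[OF is_chart_inj_on[OF charts[OF W]] z(2)])
      then show "(\<phi>' (inv_into U \<phi> (fst z)), \<psi>' (inv_into V \<psi> (snd z))) = (\<kappa>' \<circ> inv_into W \<kappa>) z"
        using smooth_atlas_chart(4)[OF M U] smooth_atlas_chart(4)[OF N V] xy by (simp add: w')
    qed
  qed
  show ?thesis
    unfolding smooth_atlas_def using frame charts cover trans by blast
qed

text \<open>The second component of z has to be a point of N for a product chart to exist around
  z.\<close>

lemma smooth_at_fst:
  fixes M :: "('a, 'e::{real_inner,banach}) manifold" and N :: "('b, 'f::{real_inner,banach}) manifold"
  assumes M: "smooth_atlas M" and N: "smooth_atlas N" and q: "snd z \<in> topspace (mtop N)"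
  shows "smooth_at (prod_manifold M N) M z fst"
  unfolding smooth_at_def
proof (intro allI impI)
  fix f assume f: "smooth_near M (fst z) f"
  obtain B :: "'e set" where B: "parseval_frame B" using smooth_atlas_frame[OF M] .
  obtain U \<phi> where U: "(U, \<phi>) \<in> atlas M" "fst z \<in> U"
    using smooth_atlas_chart_at[OF M smooth_near_topspace[OF f]] .
  obtain V \<psi> where V: "(V, \<psi>) \<in> atlas N" "snd z \<in> V" using smooth_atlas_chart_at[OF N q] .
  obtain S h where S: "open S" "\<phi> (fst z) \<in> S" "S \<subseteq> \<phi> ` U" "smooth_on S h"
    "\<And>x. x \<in> U \<Longrightarrow> \<phi> x \<in> S \<Longrightarrow> f x = h (\<phi> x)"
    using smooth_near_chartE[OF f M U] by blast
  note T = smooth_atlas_chart(3)[OF N V(1)]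
  have im: "map_prod \<phi> \<psi> ` (U \<times> V) = \<phi> ` U \<times> \<psi> ` V" by (rule map_prod_surj_on) simp_all
  show "smooth_near (prod_manifold M N) z (\<lambda>x. f (fst x))"
    by (rule smooth_near_chartI[OF smooth_atlas_prod[OF M N] prod_manifold_chart[OF U(1) V(1)] _
          open_Times[OF S(1) T] _ _ smooth_on_fst_snd(1)[OF S(1) T B S(4)]])
      (unfold im, use U V S in \<open>auto simp: mem_Times_iff\<close>)
qed

lemma smooth_at_snd:
  fixes M :: "('a, 'e::{real_inner,banach}) manifold" and N :: "('b, 'f::{real_inner,banach}) manifold"
  assumes M: "smooth_atlas M" and N: "smooth_atlas N" and p: "fst z \<in> topspace (mtop M)"
  shows "smooth_at (prod_manifold M N) N z snd"
  unfolding smooth_at_def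
proof (intro allI impI)
  fix f assume f: "smooth_near N (snd z) f"
  obtain C :: "'f set" where C: "parseval_frame C" using smooth_atlas_frame[OF N] .
  obtain U \<phi> where U: "(U, \<phi>) \<in> atlas M" "fst z \<in> U" using smooth_atlas_chart_at[OF M p] .
  obtain V \<psi> where V: "(V, \<psi>) \<in> atlas N" "snd z \<in> V"
    using smooth_atlas_chart_at[OF N smooth_near_topspace[OF f]] .
  obtain T h where T: "open T" "\<psi> (snd z) \<in> T" "T \<subseteq> \<psi> ` V" "smooth_on T h"
    "\<And>x. x \<in> V \<Longrightarrow> \<psi> x \<in> T \<Longrightarrow> f x = h (\<psi> x)"
    using smooth_near_chartE[OF f N V] by blast
  note S = smooth_atlas_chart(3)[OF M U(1)]
  have im: "map_prod \<phi> \<psi> ` (U \<times> V) = \<phi> ` U \<times> \<psi> ` V" by (rule map_prod_surj_on) simp_all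
  show "smooth_near (prod_manifold M N) z (\<lambda>x. f (snd x))"
    by (rule smooth_near_chartI[OF smooth_atlas_prod[OF M N] prod_manifold_chart[OF U(1) V(1)] _
          open_Times[OF S T(1)] _ _ smooth_on_fst_snd(2)[OF S T(1) C T(4)]])
      (unfold im, use U V T in \<open>auto simp: mem_Times_iff\<close>)
qed

text \<open>In coordinates the pair is (g, k), with g and k the representatives of F and H from
  \<open>smooth_at_chartE\<close>; f is read through the product chart.\<close>

lemma smooth_at_Pair:
  fixes M :: "('a, 'e::{real_inner,banach}) manifold" and N :: "('b, 'f::{real_inner,banach}) manifold"
  assumes L: "smooth_atlas L" and M: "smooth_atlas M" and N: "smooth_atlas N"
    and F: "smooth_at L M p F" and H: "smooth_at L N p H"
  shows "smooth_at L (prod_manifold M N) p (\<lambda>x. (F x, H x))"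
  unfolding smooth_at_def
proof (intro allI impI)
  fix f assume f: "smooth_near (prod_manifold M N) (F p, H p) f"
  have top: "F p \<in> topspace (mtop M)" "H p \<in> topspace (mtop N)"
    using smooth_near_topspace[OF f] by auto
  obtain B :: "'e set" where B: "parseval_frame B" using smooth_atlas_frame[OF M] .
  obtain C :: "'f set" where C: "parseval_frame C" using smooth_atlas_frame[OF N] .
  \<comment> \<open>This places p in the topspace of L: the pullback of the constant 1 is smooth
    near p, which is possible only at points of the space.\<close>
  have "smooth_near L p (\<lambda>x. (1::real))"
    by (rule smooth_atD[OF F smooth_near_const[OF M top(1)]])
  then obtain K \<omega> where K: "(K, \<omega>) \<in> atlas L" "p \<in> K"
    using smooth_atlas_chart_at[OF L smooth_near_topspace] by blast
  obtain U \<phi> where U: "(U, \<phi>) \<in> atlas M" "F p \<in> U" using smooth_atlas_chart_at[OF M top(1)] .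
  obtain V \<psi> where V: "(V, \<psi>) \<in> atlas N" "H p \<in> V" using smooth_atlas_chart_at[OF N top(2)] .
  have UV: "(F p, H p) \<in> U \<times> V" using U V by simp
  obtain R h where R: "open R" "map_prod \<phi> \<psi> (F p, H p) \<in> R" "R \<subseteq> map_prod \<phi> \<psi> ` (U \<times> V)" "smooth_on R h"
    "\<And>z. z \<in> U \<times> V \<Longrightarrow> map_prod \<phi> \<psi> z \<in> R \<Longrightarrow> f z = h (map_prod \<phi> \<psi> z)"
    using smooth_near_chartE[OF f smooth_atlas_prod[OF M N] prod_manifold_chart[OF U(1) V(1)] UV] by blast
  obtain S g where S: "open S" "\<omega> p \<in> S" "S \<subseteq> \<omega> ` K" "smooth_on S g"
    "\<And>x. x \<in> K \<Longrightarrow> \<omega> x \<in> S \<Longrightarrow> F x \<in> U \<and> \<phi> (F x) = g (\<omega> x)"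
    using smooth_at_chartE[OF L M F K U] by blast
  obtain T k where T: "open T" "\<omega> p \<in> T" "T \<subseteq> \<omega> ` K" "smooth_on T k"
    "\<And>x. x \<in> K \<Longrightarrow> \<omega> x \<in> T \<Longrightarrow> H x \<in> V \<and> \<psi> (H x) = k (\<omega> x)"
    using smooth_at_chartE[OF L N H K V] by blast
  let ?m = "\<lambda>z. (g z, k z)"
  have op: "open (S \<inter> T)" using S T by blast
  have m: "smooth_on (S \<inter> T) ?m"
    by (intro smooth_on_Pair op smooth_on_subset[OF S(4)] smooth_on_subset[OF T(4)]) auto
  have op': "open (S \<inter> T \<inter> ?m -` R)"
    by (rule continuous_open_preimage[OF smooth_on_imp_continuous_on[OF m] op R(1)])
  have sm: "smooth_on (S \<inter> T \<inter> ?m -` R) (\<lambda>z. h (?m z))"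
    by (rule smooth_on_compose[OF parseval_frame_prod[OF B C] op' R(1) _ smooth_on_subset[OF m] R(4)]) auto
  show "smooth_near L p (\<lambda>x. f (F x, H x))"
  proof (rule smooth_near_chartI[OF L K op' _ _ sm])
    show "\<omega> p \<in> S \<inter> T \<inter> ?m -` R" using R(2) S(2) T(2) S(5)[OF K(2)] T(5)[OF K(2)] by simp
    show "S \<inter> T \<inter> ?m -` R \<subseteq> \<omega> ` K" using S(3) by blast
    fix x assume x: "x \<in> K" "\<omega> x \<in> S \<inter> T \<inter> ?m -` R"
    then show "f (F x, H x) = h (g (\<omega> x), k (\<omega> x))"
      using S(5)[of x] T(5)[of x] R(5)[of "(F x, H x)"] by simp
  qed
qed

subsection \<open>Derivations at a point\<close>

lemma tangent_spaceD:
  assumes "D \<in> tangent_space M p"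
  shows "\<not> smooth_near M p f \<Longrightarrow> D f = 0"
    and "smooth_near M p f \<Longrightarrow> smooth_near M p g \<Longrightarrow> same_germ M p f g \<Longrightarrow> D f = D g"
    and "smooth_near M p f \<Longrightarrow> smooth_near M p g \<Longrightarrow> D (\<lambda>x. f x + g x) = D f + D g"
    and "smooth_near M p f \<Longrightarrow> D (\<lambda>x. c * f x) = c * D f"
    and "smooth_near M p f \<Longrightarrow> smooth_near M p g \<Longrightarrow> D (\<lambda>x. f x * g x) = D f * g p + f p * D g"
  using assms unfolding tangent_space_def by simp_all

lemma derivation_cong:
  assumes "D \<in> tangent_space M p" "smooth_atlas M" "smooth_near M p f"
    "openin (mtop M) W" "p \<in> W" "\<And>x. x \<in> W \<Longrightarrow> f x = g x"
  shows "D f = D g"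
  using tangent_spaceD(2)[OF assms(1,3) smooth_near_cong[OF assms(2-6)]] assms(4-6)
  unfolding same_germ_def by blast

text \<open>The Leibniz rule for 1 = 1 * 1 gives D 1 = 2 D 1, so D 1 = 0; homogeneity gives the
  other constants.\<close>

lemma derivation_const:
  assumes D: "D \<in> tangent_space M p" and M: "smooth_atlas M" and p: "p \<in> topspace (mtop M)"
  shows "D (\<lambda>x. c) = 0"
proof -
  have 1: "smooth_near M p (\<lambda>x. 1)" by (rule smooth_near_const[OF M p])
  have "D (\<lambda>x. 1) = 0" using tangent_spaceD(5)[OF D 1 1] by simp
  then show ?thesis using tangent_spaceD(4)[OF D 1, of c] by simp
qed

lemma derivation_diff:
  assumes D: "D \<in> tangent_space M p" and M: "smooth_atlas M" and f: "smooth_near M p f" and g: "smooth_near M p g"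
  shows "D (\<lambda>x. f x - g x) = D f - D g"
  using tangent_spaceD(3)[OF D f smooth_near_cmult[OF M g, of "- 1"]] tangent_spaceD(4)[OF D g, of "- 1"] by simp

lemma derivation_sum:
  assumes D: "D \<in> tangent_space M p" and M: "smooth_atlas M" and p: "p \<in> topspace (mtop M)"
    and "\<And>i. i \<in> I \<Longrightarrow> smooth_near M p (f i)"
  shows "D (\<lambda>x. \<Sum>i\<in>I. f i x) = (\<Sum>i\<in>I. D (f i))"
  using assms(4)
  by (induction I rule: infinite_finite_induct)
    (simp_all add: derivation_const[OF D M p] tangent_spaceD(3)[OF D] smooth_near_sum[OF M p])

lemma derivation_add_sum:
  assumes D: "D \<in> tangent_space M p" and M: "smooth_atlas M" and f: "smooth_near M p f"
    and g: "\<And>i. i \<in> I \<Longrightarrow> smooth_near M p (g i)"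
  shows "D (\<lambda>x. f x + (\<Sum>i\<in>I. g i x)) = D f + (\<Sum>i\<in>I. D (g i))"
proof -
  note p = smooth_near_topspace[OF f]
  have "D (\<lambda>x. f x + (\<Sum>i\<in>I. g i x)) = D f + D (\<lambda>x. \<Sum>i\<in>I. g i x)"
    by (rule tangent_spaceD(3)[OF D f smooth_near_sum[OF M p g]])
  also have "D (\<lambda>x. \<Sum>i\<in>I. g i x) = (\<Sum>i\<in>I. D (g i))"
    by (rule derivation_sum[OF D M p g])
  finally show ?thesis .
qed

section \<open>Functions of two variables and partial derivations\<close>

lemma smooth_near_slice:
  fixes M :: "('a, 'e::{real_inner,banach}) manifold" and N :: "('b, 'f::{real_inner,banach}) manifold"
  assumes M: "smooth_atlas M" and N: "smooth_atlas N" and f: "smooth_near (prod_manifold M N) (p, q) f"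
  shows "smooth_near M p (\<lambda>x. f (x, q))" "smooth_near N q (\<lambda>y. f (p, y))"
proof -
  have top: "p \<in> topspace (mtop M)" "q \<in> topspace (mtop N)" using smooth_near_topspace[OF f] by auto
  show "smooth_near M p (\<lambda>x. f (x, q))"
    by (rule smooth_atD[OF smooth_at_Pair[OF M M N smooth_at_ident smooth_at_const[OF M top(1)]] f])
  show "smooth_near N q (\<lambda>y. f (p, y))"
    by (rule smooth_atD[OF smooth_at_Pair[OF N M N smooth_at_const[OF N top(2)] smooth_at_ident] f])
qed

lemma smooth_near_prod_nhd:
  assumes "smooth_near (prod_manifold M N) (p, q) f"
  obtains U V where "openin (mtop M) U" "p \<in> U" "openin (mtop N) V" "q \<in> V"
    "\<And>x y. x \<in> U \<Longrightarrow> y \<in> V \<Longrightarrow> smooth_near (prod_manifold M N) (x, y) f"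
proof -
  obtain W where W: "openin (prod_topology (mtop M) (mtop N)) W" "(p, q) \<in> W"
    "\<And>z. z \<in> W \<Longrightarrow> smooth_near (prod_manifold M N) z f"
    by (rule smooth_near_nhd[OF assms, unfolded mtop_prod_manifold]) blast
  obtain U V where "openin (mtop M) U" "p \<in> U" "openin (mtop N) V" "q \<in> V" "U \<times> V \<subseteq> W"
    using W(1)[unfolded openin_prod_topology_alt, rule_format, OF W(2)] by blast
  with W(3) that show thesis by blast
qed

text \<open>Hadamard's lemma read in a product chart: the coordinates relative to \<psi> q serve as
  \<open>u c\<close>, and the identity holds on the preimages of the two balls.\<close>

lemma smooth_near_Hadamard:
  fixes M :: "('a, 'e::{real_inner,banach}) manifold" and N :: "('b, 'f::{real_inner,banach}) manifold"
  assumes M: "smooth_atlas M" and N: "smooth_atlas N" and f: "smooth_near (prod_manifold M N) (p, q) f"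
  obtains C :: "'f set" and U V u G where "finite C"
    "openin (mtop M) U" "p \<in> U" "openin (mtop N) V" "q \<in> V"
    "\<forall>c. smooth_near N q (u c)" "\<forall>c. u c q = 0" "\<forall>c. smooth_near (prod_manifold M N) (p, q) (G c)"
    "\<forall>x\<in>U. \<forall>y\<in>V. f (x, y) = f (x, q) + (\<Sum>c\<in>C. u c y * G c (x, y))"
proof -
  have top: "p \<in> topspace (mtop M)" "q \<in> topspace (mtop N)" using smooth_near_topspace[OF f] by auto
  obtain B :: "'e set" where B: "parseval_frame B" using smooth_atlas_frame[OF M] .
  obtain C :: "'f set" where C: "parseval_frame C" using smooth_atlas_frame[OF N] .
  obtain U \<phi> where U: "(U, \<phi>) \<in> atlas M" "p \<in> U" using smooth_atlas_chart_at[OF M top(1)] .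
  obtain V \<psi> where V: "(V, \<psi>) \<in> atlas N" "q \<in> V" using smooth_atlas_chart_at[OF N top(2)] .
  have UV: "(p, q) \<in> U \<times> V" using U V by simp
  obtain R h where R: "open R" "map_prod \<phi> \<psi> (p, q) \<in> R" "R \<subseteq> map_prod \<phi> \<psi> ` (U \<times> V)" "smooth_on R h"
    "\<And>z. z \<in> U \<times> V \<Longrightarrow> map_prod \<phi> \<psi> z \<in> R \<Longrightarrow> f z = h (map_prod \<phi> \<psi> z)"
    using smooth_near_chartE[OF f smooth_atlas_prod[OF M N] prod_manifold_chart[OF U(1) V(1)] UV] by blast
  have R2: "(\<phi> p, \<psi> q) \<in> R" using R(2) by simp
  obtain r g where r: "r > 0" "ball (\<phi> p) r \<times> ball (\<psi> q) r \<subseteq> R"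
    "\<And>c. smooth_on (ball (\<phi> p) r \<times> ball (\<psi> q) r) (g c)"
    "\<And>x y. x \<in> ball (\<phi> p) r \<Longrightarrow> y \<in> ball (\<psi> q) r \<Longrightarrow>
      h (x, y) = h (x, \<psi> q) + (\<Sum>c\<in>C. ((y - \<psi> q) \<bullet> c) * g c (x, y))"
    using smooth_on_Hadamard[OF B C R(4,1) R2] by blast
  let ?u = "\<lambda>c y. (\<psi> y + - \<psi> q) \<bullet> c" and ?G = "\<lambda>c z. g c (map_prod \<phi> \<psi> z)"
  let ?U = "U \<inter> \<phi> -` ball (\<phi> p) r" and ?V = "V \<inter> \<psi> -` ball (\<psi> q) r"
  show thesis
  proof (rule that[of C ?U ?V ?u ?G])
    show "finite C" using parseval_frameD(1)[OF C] .
    show "openin (mtop M) ?U" "p \<in> ?U" "openin (mtop N) ?V" "q \<in> ?V"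
      using smooth_atlas_chart(6)[OF M U(1)] smooth_atlas_chart(6)[OF N V(1)] U V r(1) by auto
    note T = smooth_atlas_chart(3)[OF N V(1)]
    show "\<forall>c. smooth_near N q (?u c)"
    proof
      fix c
      show "smooth_near N q (?u c)"
        by (rule smooth_near_chartI[OF N V T _ _ smooth_on_bounded_linear[OF bounded_linear_inner_left[of c]
              smooth_on_add[OF T smooth_on_ident[OF T] smooth_on_const[where c = "- \<psi> q"]] T]])
        (use V in auto)
    qed
    show "\<forall>c. ?u c q = 0" by simp
    show "\<forall>c. smooth_near (prod_manifold M N) (p, q) (?G c)"
      by (rule allI, rule smooth_near_chartI[OF smooth_atlas_prod[OF M N] prod_manifold_chart[OF U(1) V(1)] UV
            open_Times[OF open_ball open_ball] _ _ r(3)]) (use r R in auto)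
    show "\<forall>x\<in>?U. \<forall>y\<in>?V. f (x, y) = f (x, q) + (\<Sum>c\<in>C. ?u c y * ?G c (x, y))"
    proof (intro ballI)
      fix x y assume that: "x \<in> ?U" "y \<in> ?V"
      have "(\<phi> x, \<psi> y) \<in> R" "(\<phi> x, \<psi> q) \<in> R" using that r(1,2) by auto
      then have "f (x, y) = h (\<phi> x, \<psi> y)" "f (x, q) = h (\<phi> x, \<psi> q)"
        using R(5)[of "(x, y)"] R(5)[of "(x, q)"] that V(2) by auto
      then show "f (x, y) = f (x, q) + (\<Sum>c\<in>C. ?u c y * ?G c (x, y))"
        using r(4)[of "\<phi> x" "\<psi> y"] that by simp
    qed
  qed
qed

text \<open>
  By Hadamard's lemma a derivation in the second variable acts on \<open>f\<close> through finitely many smooth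
  coefficients; this replaces the representation of derivations by coordinate vectors.
\<close>

lemma partial_derivation_expansion:
  fixes M :: "('a, 'e::{real_inner,banach}) manifold" and N :: "('b, 'f::{real_inner,banach}) manifold"
  assumes M: "smooth_atlas M" and N: "smooth_atlas N" and f: "smooth_near (prod_manifold M N) (p, q) f"
  obtains C :: "'f set" and U V u G where "finite C"
    "openin (mtop M) U" "p \<in> U" "openin (mtop N) V" "q \<in> V"
    "\<forall>c. smooth_near N q (u c)" "\<forall>c. u c q = 0" "\<forall>c. smooth_near (prod_manifold M N) (p, q) (G c)"
    "\<forall>x\<in>U. \<forall>y\<in>V. f (x, y) = f (x, q) + (\<Sum>c\<in>C. u c y * G c (x, y))"
    "\<forall>E\<in>tangent_space N q. \<forall>x\<in>U. E (\<lambda>y. f (x, y)) = (\<Sum>c\<in>C. E (u c) * G c (x, q))"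
proof -
  obtain C :: "'f set" and U V u G where C: "finite C"
    and U: "openin (mtop M) U" "p \<in> U" and V: "openin (mtop N) V" "q \<in> V"
    and u_all: "\<forall>c. smooth_near N q (u c)" "\<forall>c. u c q = 0" and G_all: "\<forall>c. smooth_near (prod_manifold M N) (p, q) (G c)"
    and eq_all: "\<forall>x\<in>U. \<forall>y\<in>V. f (x, y) = f (x, q) + (\<Sum>c\<in>C. u c y * G c (x, y))"
    using smooth_near_Hadamard[OF M N f] .
  note u = u_all[rule_format] and G = G_all[rule_format] and eq = eq_all[rule_format]
  have q: "q \<in> topspace (mtop N)" using smooth_near_topspace[OF f] by simp
  \<comment> \<open>\<open>G c\<close> is smooth near (x, q) for all x close to p, so E can be
    applied to its slice at each such x and not only at p.\<close>
  have "\<exists>W. openin (mtop M) W \<and> p \<in> W \<and> (\<forall>x\<in>W. smooth_near (prod_manifold M N) (x, q) (G c))" for c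
    using smooth_near_prod_nhd[OF G[of c]] by metis
  then obtain W where W: "\<And>c. openin (mtop M) (W c)" "\<And>c. p \<in> W c"
    "\<And>c x. x \<in> W c \<Longrightarrow> smooth_near (prod_manifold M N) (x, q) (G c)"
    by metis
  let ?U = "U \<inter> (\<Inter>c\<in>C. W c)"
  \<comment> \<open>For \<open>C = {}\<close> the intersection of the sets \<open>W c\<close> is
    \<open>UNIV\<close> and \<open>?U\<close> is U itself, hence the case distinction.\<close>
  have U': "openin (mtop M) ?U"
    using openin_INT2[OF C] U(1) W(1) by (cases "C = {}") (auto intro: openin_Int)
  have p: "p \<in> ?U" using U W by simp
  have E_eq: "E (\<lambda>y. f (x, y)) = (\<Sum>c\<in>C. E (u c) * G c (x, q))"
    if E: "E \<in> tangent_space N q" and x: "x \<in> ?U" for E x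
  proof -
    have G': "smooth_near N q (\<lambda>y. G c (x, y))" if "c \<in> C" for c
      using smooth_near_slice(2)[OF M N W(3)[of x c]] x that by simp
    then have uG: "smooth_near N q (\<lambda>y. u c y * G c (x, y))" if "c \<in> C" for c
      using smooth_near_add_mult(2)[OF N u(1)] that by blast
    note c = smooth_near_const[OF N q, of "f (x, q)"]
    have sm: "smooth_near N q (\<lambda>y. f (x, q) + (\<Sum>c\<in>C. u c y * G c (x, y)))"
      by (rule smooth_near_add_mult(1)[OF N c smooth_near_sum[OF N q uG]])
    have "E (\<lambda>y. f (x, y)) = E (\<lambda>y. f (x, q) + (\<Sum>c\<in>C. u c y * G c (x, y)))"
      using x by (intro derivation_cong[OF E N sm V, symmetric] eq[symmetric]) auto
    also have "\<dots> = E (\<lambda>y. f (x, q)) + (\<Sum>c\<in>C. E (\<lambda>y. u c y * G c (x, y)))"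
      by (rule derivation_add_sum[OF E N c uG])
    also have "\<dots> = (\<Sum>c\<in>C. E (\<lambda>y. u c y * G c (x, y)))"
      by (simp add: derivation_const[OF E N q])
    also have "\<dots> = (\<Sum>c\<in>C. E (u c) * G c (x, q))"
      using tangent_spaceD(5)[OF E u(1) G'] u(2) by (intro sum.cong) auto
    finally show ?thesis .
  qed
  show thesis
  proof (rule that[OF C U' p V u_all G_all])
    show "\<forall>x\<in>?U. \<forall>y\<in>V. f (x, y) = f (x, q) + (\<Sum>c\<in>C. u c y * G c (x, y))"
      using eq_all by blast
    show "\<forall>E\<in>tangent_space N q. \<forall>x\<in>?U. E (\<lambda>y. f (x, y)) = (\<Sum>c\<in>C. E (u c) * G c (x, q))"
      by (intro ballI E_eq)
  qed
qed

text \<open>Near p the function is the sum of the \<open>E (u c) * G c (x, q)\<close>: constants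
  times slices of smooth functions.\<close>

lemma smooth_near_partial_derivation:
  fixes M :: "('a, 'e::{real_inner,banach}) manifold" and N :: "('b, 'f::{real_inner,banach}) manifold"
  assumes M: "smooth_atlas M" and N: "smooth_atlas N" and f: "smooth_near (prod_manifold M N) (p, q) f"
    and E: "E \<in> tangent_space N q"
  shows "smooth_near M p (\<lambda>x. E (\<lambda>y. f (x, y)))"
proof -
  have p: "p \<in> topspace (mtop M)" using smooth_near_topspace[OF f] by simp
  obtain C :: "'f set" and U V u G where C: "finite C"
    and U: "openin (mtop M) U" "p \<in> U" and V: "openin (mtop N) V" "q \<in> V"
    and u_all: "\<forall>c. smooth_near N q (u c)" "\<forall>c. u c q = 0" and G_all: "\<forall>c. smooth_near (prod_manifold M N) (p, q) (G c)"
    and eq_all: "\<forall>x\<in>U. \<forall>y\<in>V. f (x, y) = f (x, q) + (\<Sum>c\<in>C. u c y * G c (x, y))"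
    and E_all: "\<forall>E\<in>tangent_space N q. \<forall>x\<in>U.
      E (\<lambda>y. f (x, y)) = (\<Sum>c\<in>C. E (u c) * G c (x, q))"
    using partial_derivation_expansion[OF M N f] .
  note G = G_all[rule_format] and E_eq = E_all[rule_format, OF E]
  have "smooth_near M p (\<lambda>x. \<Sum>c\<in>C. E (u c) * G c (x, q))"
    by (intro smooth_near_sum[OF M p] smooth_near_cmult[OF M] smooth_near_slice(1)[OF M N G])
  then show ?thesis
    by (rule smooth_near_cong[OF M _ U]) (simp add: E_eq)
qed

lemma smooth_near_swap:
  fixes M :: "('a, 'e::{real_inner,banach}) manifold" and N :: "('b, 'f::{real_inner,banach}) manifold"
  assumes M: "smooth_atlas M" and N: "smooth_atlas N" and f: "smooth_near (prod_manifold M N) (p, q) f"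
  shows "smooth_near (prod_manifold N M) (q, p) (\<lambda>z. f (snd z, fst z))"
proof -
  have top: "p \<in> topspace (mtop M)" "q \<in> topspace (mtop N)" using smooth_near_topspace[OF f] by auto
  have "smooth_at (prod_manifold N M) (prod_manifold M N) (q, p) (\<lambda>z. (snd z, fst z))"
    using top by (intro smooth_at_Pair smooth_atlas_prod M N smooth_at_fst smooth_at_snd) auto
  from smooth_atD[OF this, of f] f show ?thesis by simp
qed

text \<open>Both sides equal the sum of the \<open>E (u c) * D (\<lambda>x. G c (x, q))\<close>. On
  the left D acts on the expansion of E f(x, .). On the right D is applied first, for each y near q,
  and then E by the Leibniz rule, where \<open>u c q\<close> = 0 removes the derivative of y |-> D
  G_c(., y).\<close>

lemma derivations_commute:
  fixes M :: "('a, 'e::{real_inner,banach}) manifold" and N :: "('b, 'f::{real_inner,banach}) manifold"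
  assumes M: "smooth_atlas M" and N: "smooth_atlas N" and f: "smooth_near (prod_manifold M N) (p, q) f"
    and D: "D \<in> tangent_space M p" and E: "E \<in> tangent_space N q"
  shows "D (\<lambda>x. E (\<lambda>y. f (x, y))) = E (\<lambda>y. D (\<lambda>x. f (x, y)))"
proof -
  have top: "p \<in> topspace (mtop M)" "q \<in> topspace (mtop N)" using smooth_near_topspace[OF f] by auto
  obtain C :: "'f set" and U V u G where C: "finite C"
    and U: "openin (mtop M) U" "p \<in> U" and V: "openin (mtop N) V" "q \<in> V"
    and u_all: "\<forall>c. smooth_near N q (u c)" "\<forall>c. u c q = 0" and G_all: "\<forall>c. smooth_near (prod_manifold M N) (p, q) (G c)"
    and eq_all: "\<forall>x\<in>U. \<forall>y\<in>V. f (x, y) = f (x, q) + (\<Sum>c\<in>C. u c y * G c (x, y))"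
    and E_all: "\<forall>E\<in>tangent_space N q. \<forall>x\<in>U.
      E (\<lambda>y. f (x, y)) = (\<Sum>c\<in>C. E (u c) * G c (x, q))"
    using partial_derivation_expansion[OF M N f] .
  note u = u_all[rule_format] and G = G_all[rule_format] and eq = eq_all[rule_format]
    and E_eq = E_all[rule_format, OF E]
  note G1 = smooth_near_slice(1)[OF M N G]
  have sm: "smooth_near M p (\<lambda>x. \<Sum>c\<in>C. E (u c) * G c (x, q))"
    by (intro smooth_near_sum[OF M top(1)] smooth_near_cmult[OF M] G1)
  have "D (\<lambda>x. E (\<lambda>y. f (x, y))) = D (\<lambda>x. \<Sum>c\<in>C. E (u c) * G c (x, q))"
    by (intro derivation_cong[OF D M sm U, symmetric] E_eq[symmetric])
  also have "\<dots> = (\<Sum>c\<in>C. E (u c) * D (\<lambda>x. G c (x, q)))"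
    using derivation_sum[OF D M top(1) smooth_near_cmult[OF M G1]] tangent_spaceD(4)[OF D G1] by simp
  finally have lhs: "D (\<lambda>x. E (\<lambda>y. f (x, y))) = (\<Sum>c\<in>C. E (u c) * D (\<lambda>x. G c (x, q)))" .

  have "\<exists>W. openin (mtop N) W \<and> q \<in> W \<and> (\<forall>y\<in>W. smooth_near (prod_manifold M N) (p, y) (G c))" for c
    using smooth_near_prod_nhd[OF G[of c]] by metis
  then obtain W where W: "\<And>c. openin (mtop N) (W c)" "\<And>c. q \<in> W c"
    "\<And>c y. y \<in> W c \<Longrightarrow> smooth_near (prod_manifold M N) (p, y) (G c)"
    by metis
  let ?V = "V \<inter> (\<Inter>c\<in>C. W c)"
  have V': "openin (mtop N) ?V" "q \<in> ?V"
  proof -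
    show "openin (mtop N) ?V"
      using openin_INT2[OF C] V(1) W(1) by (cases "C = {}") (auto intro: openin_Int)
    show "q \<in> ?V" using V(2) W(2) by blast
  qed
  have D_eq: "D (\<lambda>x. f (x, y)) = D (\<lambda>x. f (x, q)) + (\<Sum>c\<in>C. u c y * D (\<lambda>x. G c (x, y)))" if y: "y \<in> ?V" for y
  proof -
    have G': "smooth_near M p (\<lambda>x. G c (x, y))" if "c \<in> C" for c
      using smooth_near_slice(1)[OF M N W(3)[of y c]] y that by simp
    note uG = smooth_near_cmult[OF M G']
    note f1 = smooth_near_slice(1)[OF M N f]
    have sm: "smooth_near M p (\<lambda>x. f (x, q) + (\<Sum>c\<in>C. u c y * G c (x, y)))"
      by (rule smooth_near_add_mult(1)[OF M f1 smooth_near_sum[OF M top(1) uG]])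
    have "D (\<lambda>x. f (x, y)) = D (\<lambda>x. f (x, q) + (\<Sum>c\<in>C. u c y * G c (x, y)))"
      using y by (intro derivation_cong[OF D M sm U, symmetric] eq[symmetric]) auto
    also have "\<dots> = D (\<lambda>x. f (x, q)) + (\<Sum>c\<in>C. D (\<lambda>x. u c y * G c (x, y)))"
      by (rule derivation_add_sum[OF D M f1 uG])
    also have "(\<Sum>c\<in>C. D (\<lambda>x. u c y * G c (x, y))) = (\<Sum>c\<in>C. u c y * D (\<lambda>x. G c (x, y)))"
      using tangent_spaceD(4)[OF D G'] by (intro sum.cong) auto
    finally show ?thesis .
  qed
  have DG: "smooth_near N q (\<lambda>y. D (\<lambda>x. G c (x, y)))" for c
    using smooth_near_partial_derivation[OF N M smooth_near_swap[OF M N G] D] by simp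
  note uDG = smooth_near_add_mult(2)[OF N u(1) DG]
  note c = smooth_near_const[OF N top(2), of "D (\<lambda>x. f (x, q))"]
  have "E (\<lambda>y. D (\<lambda>x. f (x, y))) = E (\<lambda>y. D (\<lambda>x. f (x, q)) + (\<Sum>c\<in>C. u c y * D (\<lambda>x. G c (x, y))))"
    by (intro derivation_cong[OF E N smooth_near_add_mult(1)[OF N c smooth_near_sum[OF N top(2) uDG]] V', symmetric]
        D_eq[symmetric])
  also have "\<dots> = E (\<lambda>y. D (\<lambda>x. f (x, q))) + (\<Sum>c\<in>C. E (\<lambda>y. u c y * D (\<lambda>x. G c (x, y))))"
    by (rule derivation_add_sum[OF E N c uDG])
  also have "\<dots> = (\<Sum>c\<in>C. E (\<lambda>y. u c y * D (\<lambda>x. G c (x, y))))"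
    by (simp add: derivation_const[OF E N top(2)])
  also have "\<dots> = (\<Sum>c\<in>C. E (u c) * D (\<lambda>x. G c (x, q)))"
    using tangent_spaceD(5)[OF E u(1) DG] u(2) by simp
  finally show ?thesis using lhs by simp
qed

text \<open>On the diagonal the expansion reads f(x, x) = f(x, p) + sum of
  \<open>u c x * G c (x, x)\<close>. The Leibniz rule reduces the sum to that of
  \<open>D (u c) * G c (p, p)\<close>, which is the expansion of D f(p, .).\<close>

lemma derivation_diagonal:
  fixes M :: "('a, 'e::{real_inner,banach}) manifold"
  assumes M: "smooth_atlas M" and f: "smooth_near (prod_manifold M M) (p, p) f" and D: "D \<in> tangent_space M p"
  shows "D (\<lambda>x. f (x, x)) = D (\<lambda>x. f (x, p)) + D (\<lambda>x. f (p, x))"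
proof -
  have p: "p \<in> topspace (mtop M)" using smooth_near_topspace[OF f] by simp
  obtain C :: "'e set" and U V u G where C: "finite C"
    and U: "openin (mtop M) U" "p \<in> U" and V: "openin (mtop M) V" "p \<in> V"
    and u_all: "\<forall>c. smooth_near M p (u c)" "\<forall>c. u c p = 0" and G_all: "\<forall>c. smooth_near (prod_manifold M M) (p, p) (G c)"
    and eq_all: "\<forall>x\<in>U. \<forall>y\<in>V. f (x, y) = f (x, p) + (\<Sum>c\<in>C. u c y * G c (x, y))"
    and E_all: "\<forall>E\<in>tangent_space M p. \<forall>x\<in>U.
      E (\<lambda>y. f (x, y)) = (\<Sum>c\<in>C. E (u c) * G c (x, p))"
    using partial_derivation_expansion[OF M M f] .
  note u = u_all[rule_format] and G = G_all[rule_format] and eq = eq_all[rule_format]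
    and D_eq = E_all[rule_format, OF D]
  have G': "smooth_near M p (\<lambda>x. G c (x, x))" for c
    by (rule smooth_atD[OF smooth_at_Pair[OF M M M smooth_at_ident smooth_at_ident] G])
  note uG = smooth_near_add_mult(2)[OF M u(1) G']
  note f1 = smooth_near_slice(1)[OF M M f]
  have "D (\<lambda>x. f (x, x)) = D (\<lambda>x. f (x, p) + (\<Sum>c\<in>C. u c x * G c (x, x)))"
    using U V by (intro derivation_cong[OF D M smooth_near_add_mult(1)[OF M f1 smooth_near_sum[OF M p uG]]
        openin_Int[OF U(1) V(1)], symmetric] eq[symmetric]) auto
  also have "\<dots> = D (\<lambda>x. f (x, p)) + (\<Sum>c\<in>C. D (\<lambda>x. u c x * G c (x, x)))"
    by (rule derivation_add_sum[OF D M f1 uG])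
  also have "(\<Sum>c\<in>C. D (\<lambda>x. u c x * G c (x, x))) = D (\<lambda>y. f (p, y))"
    using tangent_spaceD(5)[OF D u(1) G'] u(2) D_eq[OF U(2)] by simp
  finally show ?thesis .
qed

subsection \<open>Left convolution of derivations on a Lie group\<close>

lemma eventually_nhdsinI:
  "openin X W \<Longrightarrow> a \<in> W \<Longrightarrow> (\<And>x. x \<in> W \<Longrightarrow> P x) \<Longrightarrow> eventually P (nhdsin X a)"
  unfolding eventually_nhdsin by blast

lemma smooth_near_eventually:
  assumes "smooth_near M p f"
  shows "\<forall>\<^sub>F x in nhdsin (mtop M) p. smooth_near M x f"
  by (rule smooth_near_nhd[OF assms]) (rule eventually_nhdsinI)

text \<open>Outside the space \<open>nhdsin\<close> makes every property hold eventually; smoothness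
  of f near p excludes that vacuous case.\<close>

lemma derivation_cong_eventually:
  assumes "D \<in> tangent_space M p" "smooth_atlas M" "smooth_near M p f"
    "\<forall>\<^sub>F x in nhdsin (mtop M) p. f x = g x"
  shows "D f = D g"
  using derivation_cong[OF assms(1-3)] assms(4) smooth_near_topspace[OF assms(3)]
  unfolding eventually_nhdsin by blast

lemma smooth_at_eventually:
  assumes "smooth_atlas M" "smooth_atlas N" "smooth_at M N p F" "F p \<in> topspace (mtop N)"
    "\<forall>\<^sub>F y in nhdsin (mtop N) (F p). P y"
  shows "\<forall>\<^sub>F x in nhdsin (mtop M) p. P (F x)"
proof -
  obtain V where V: "openin (mtop N) V" "F p \<in> V" "\<And>y. y \<in> V \<Longrightarrow> P y"
    using assms(4,5) unfolding eventually_nhdsin by blast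
  obtain W where "openin (mtop M) W" "p \<in> W" "F ` W \<subseteq> V"
    using smooth_at_nhd[OF assms(1-3) V(1,2)] .
  with V(3) show ?thesis by (intro eventually_nhdsinI) blast+
qed

section \<open>Translations and left-invariant fields\<close>

locale lie_grp =
  fixes G :: "('a, 'b) monoid_scheme" (structure) and M :: "('a, 'e::{real_inner,banach}) manifold"
  assumes lie_group: "lie_group G M"

sublocale lie_grp \<subseteq> group G
  using lie_group by (simp add: lie_group_def)

context lie_grp
begin

abbreviation T where "T \<equiv> tangent_space M \<one>"

lemma atlas: "smooth_atlas M"
  using lie_group by (simp add: lie_group_def smooth_manifold_imp_smooth_atlas)

lemma topspace: "topspace (mtop M) = carrier G"
  using lie_group by (simp add: lie_group_def)

lemma one_topspace: "\<one> \<in> topspace (mtop M)"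
  by (simp add: topspace)

lemma smooth_near_carrier: "smooth_near M p f \<Longrightarrow> p \<in> carrier G"
  using smooth_near_topspace[of M p f] by (simp only: topspace)

lemma smooth_at_mult:
  assumes N: "smooth_atlas N" and F: "smooth_at N M p F" and H: "smooth_at N M p H"
    and "F p \<in> carrier G" "H p \<in> carrier G"
  shows "smooth_at N M p (\<lambda>x. F x \<otimes> H x)"
proof -
  have "smooth_at (prod_manifold M M) M (F p, H p) (\<lambda>(x, y). x \<otimes> y)"
    using lie_group assms(4,5)
    by (intro smooth_map_imp_smooth_at smooth_atlas_prod atlas) (simp_all add: lie_group_def)
  from smooth_at_compose[OF smooth_at_Pair[OF N atlas atlas F H] this] show ?thesis by simp
qed

lemma smooth_at_inv:
  assumes F: "smooth_at N M p F" and "F p \<in> carrier G"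
  shows "smooth_at N M p (\<lambda>x. inv (F x))"
proof -
  have "smooth_at M M (F p) (\<lambda>x. inv x)"
    using lie_group assms(2) by (intro smooth_map_imp_smooth_at atlas) (auto simp: lie_group_def)
  from smooth_at_compose[OF F this] show ?thesis .
qed

lemma smooth_at_translate:
  assumes "x \<in> carrier G" "p \<in> carrier G"
  shows "smooth_at M M p (\<lambda>y. x \<otimes> y)"
  using assms by (intro smooth_at_mult atlas smooth_at_const smooth_at_ident) (auto simp: topspace)

lemma smooth_near_translate:
  assumes "smooth_near M x f"
  shows "smooth_near M \<one> (\<lambda>y. f (x \<otimes> y))"
  using smooth_atD[OF smooth_at_translate, of x \<one> f] smooth_near_carrier[OF assms] assms by simp

lemma eventually_translate:
  assumes "x \<in> carrier G" "\<forall>\<^sub>F z in nhdsin (mtop M) x. P z"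
  shows "\<forall>\<^sub>F y in nhdsin (mtop M) \<one>. P (x \<otimes> y)"
  by (rule smooth_at_eventually[OF atlas atlas smooth_at_translate]) (use assms in \<open>auto simp: topspace\<close>)

lemma eventually_carrier: "p \<in> carrier G \<Longrightarrow> \<forall>\<^sub>F x in nhdsin (mtop M) p. x \<in> carrier G"
  by (rule eventually_nhdsinI[OF openin_topspace]) (simp_all add: topspace)

lemma smooth_near_mult:
  assumes "smooth_near M \<one> f"
  shows "smooth_near (prod_manifold M M) (\<one>, \<one>) (\<lambda>z. f (fst z \<otimes> snd z))"
proof -
  have "smooth_at (prod_manifold M M) M (\<one>, \<one>) (\<lambda>z. fst z \<otimes> snd z)"
    by (intro smooth_at_mult smooth_atlas_prod atlas smooth_at_fst smooth_at_snd) (auto simp: topspace)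
  from smooth_atD[OF this, of f] assms show ?thesis by simp
qed

text \<open>
  \<open>L E\<close> is the left-invariant field of \<open>E\<close> acting on functions, without the junk value 0 at points
  where the function is not smooth.
\<close>

definition L :: "(('a \<Rightarrow> real) \<Rightarrow> real) \<Rightarrow> ('a \<Rightarrow> real) \<Rightarrow> 'a \<Rightarrow> real" where
  "L E f x = E (\<lambda>y. f (x \<otimes> y))"

lemma smooth_near_L:
  assumes "E \<in> T" "smooth_near M \<one> f"
  shows "smooth_near M \<one> (L E f)"
  unfolding L_def[abs_def]
  using smooth_near_partial_derivation[OF atlas atlas smooth_near_mult[OF assms(2)] assms(1)] by simp

text \<open>The unit law holds only on the carrier, so the two functions are compared as
  germs.\<close>

lemma L_one:
  assumes E: "E \<in> T" and f: "smooth_near M \<one> f"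
  shows "L E f \<one> = E f"
proof -
  have "\<forall>\<^sub>F y in nhdsin (mtop M) \<one>. f y = f (\<one> \<otimes> y)"
    using eventually_carrier[OF one_closed] by eventually_elim simp
  from derivation_cong_eventually[OF E atlas f this] show ?thesis by (simp add: L_def)
qed

text \<open>\<open>L E f x\<close> sees the germ of f at x. The open set W on which f and g agree is
  a neighbourhood of each of its points, so the germs agree at all x near the identity.\<close>

lemma L_cong:
  assumes E: "E \<in> T" and f: "smooth_near M \<one> f"
    and fg: "\<forall>\<^sub>F x in nhdsin (mtop M) \<one>. f x = g x"
  shows "\<forall>\<^sub>F x in nhdsin (mtop M) \<one>. L E f x = L E g x"
proof -
  obtain W where W: "openin (mtop M) W" "\<one> \<in> W" "\<And>x. x \<in> W \<Longrightarrow> f x = g x"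
    using fg one_topspace unfolding eventually_nhdsin by blast
  have "\<forall>\<^sub>F x in nhdsin (mtop M) \<one>. x \<in> W" using W(1,2) by (rule eventually_nhdsinI)
  with smooth_near_eventually[OF f] show ?thesis
  proof eventually_elim
    fix x assume x: "smooth_near M x f" "x \<in> W"
    have "\<forall>\<^sub>F z in nhdsin (mtop M) x. f z = g z"
      by (rule eventually_nhdsinI[OF W(1) x(2) W(3)])
    from derivation_cong_eventually[OF E atlas smooth_near_translate[OF x(1)]
        eventually_translate[OF smooth_near_carrier[OF x(1)] this]]
    show "L E f x = L E g x" by (simp add: L_def)
  qed
qed

lemma L_add:
  assumes E: "E \<in> T" and f: "smooth_near M \<one> f" and g: "smooth_near M \<one> g"
  shows "\<forall>\<^sub>F x in nhdsin (mtop M) \<one>. L E f x + L E g x = L E (\<lambda>x. f x + g x) x"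
  using smooth_near_eventually[OF f] smooth_near_eventually[OF g]
  by eventually_elim (simp add: L_def tangent_spaceD(3)[OF E] smooth_near_translate)

lemma L_cmult:
  assumes E: "E \<in> T" and f: "smooth_near M \<one> f"
  shows "\<forall>\<^sub>F x in nhdsin (mtop M) \<one>. c * L E f x = L E (\<lambda>x. c * f x) x"
  using smooth_near_eventually[OF f]
  by eventually_elim (simp add: L_def tangent_spaceD(4)[OF E] smooth_near_translate)

lemma L_mult:
  assumes E: "E \<in> T" and f: "smooth_near M \<one> f" and g: "smooth_near M \<one> g"
  shows "\<forall>\<^sub>F x in nhdsin (mtop M) \<one>. L E f x * g x + f x * L E g x = L E (\<lambda>x. f x * g x) x"
  using smooth_near_eventually[OF f] smooth_near_eventually[OF g]
  by eventually_elim
    (simp add: L_def tangent_spaceD(5)[OF E] smooth_near_translate smooth_near_carrier)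

text \<open>Left invariance: by associativity of the group, \<open>L Z\<close> commutes with
  translation by x. In terms of convolution words this is the associativity that lets a bracket be
  inserted into a bracket.\<close>

lemma L_L:
  assumes Y: "Y \<in> T" and Z: "Z \<in> T" and f: "smooth_near M x f"
  shows "Y (L Z (\<lambda>y. f (x \<otimes> y))) = L Y (L Z f) x"
proof -
  have x: "x \<in> carrier G" using smooth_near_carrier[OF f] .
  have "\<forall>\<^sub>F z in nhdsin (mtop M) \<one>. smooth_near M (x \<otimes> z) f"
    by (rule eventually_translate[OF x smooth_near_eventually[OF f]])
  then have "\<forall>\<^sub>F z in nhdsin (mtop M) \<one>. L Z (\<lambda>y. f (x \<otimes> y)) z = L Z f (x \<otimes> z)"
    using eventually_carrier[OF one_closed]
  proof eventually_elim
    fix z assume z: "smooth_near M (x \<otimes> z) f" "z \<in> carrier G"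
    have "\<forall>\<^sub>F y in nhdsin (mtop M) \<one>. f (x \<otimes> z \<otimes> y) = f (x \<otimes> (z \<otimes> y))"
      using eventually_carrier[OF one_closed] by eventually_elim (simp add: m_assoc x z)
    from derivation_cong_eventually[OF Z atlas smooth_near_translate[OF z(1)] this]
    show "L Z (\<lambda>y. f (x \<otimes> y)) z = L Z f (x \<otimes> z)" by (simp add: L_def)
  qed
  from derivation_cong_eventually[OF Y atlas smooth_near_L[OF Z smooth_near_translate[OF f]] this]
  show ?thesis by (simp add: L_def[abs_def])
qed

subsection \<open>The Lie algebra of a Lie group\<close>

text \<open>f is smooth near every x close to the identity, so there the default 0 of
  \<open>left_invariant_field\<close> does not occur; D and E see only this germ.\<close>

lemma lie_bracket_eq:
  assumes D: "D \<in> T" and E: "E \<in> T" and f: "smooth_near M \<one> f"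
  shows "lie_bracket G M D E f = D (L E f) - E (L D f)"
proof -
  have eq: "\<forall>\<^sub>F x in nhdsin (mtop M) \<one>. L X f x = left_invariant_field G M X x f" for X
    using smooth_near_eventually[OF f]
    by eventually_elim
      (simp add: L_def left_invariant_field_def differential_def smooth_near_carrier o_def)
  show ?thesis
    using derivation_cong_eventually[OF D atlas smooth_near_L[OF E f] eq]
      derivation_cong_eventually[OF E atlas smooth_near_L[OF D f] eq] f
    by (simp add: lie_bracket_def)
qed

lemma lie_bracket_nonsmooth: "\<not> smooth_near M \<one> f \<Longrightarrow> lie_bracket G M D E f = 0"
  by (simp add: lie_bracket_def)

lemma derivation_L_add:
  assumes D: "D \<in> T" and E: "E \<in> T" and f: "smooth_near M \<one> f" and g: "smooth_near M \<one> g"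
  shows "D (L E (\<lambda>x. f x + g x)) = D (L E f) + D (L E g)"
  using derivation_cong_eventually[OF D atlas _ L_add[OF E f g]] D E f g
  by (simp add: tangent_spaceD(3)[OF D] smooth_near_add_mult(1)[OF atlas] smooth_near_L)

lemma derivation_L_cmult:
  assumes D: "D \<in> T" and E: "E \<in> T" and f: "smooth_near M \<one> f"
  shows "D (L E (\<lambda>x. c * f x)) = c * D (L E f)"
  using derivation_cong_eventually[OF D atlas _ L_cmult[OF E f]] D E f
  by (simp add: tangent_spaceD(4)[OF D] smooth_near_cmult[OF atlas] smooth_near_L)

text \<open>A second-order Leibniz rule. The mixed terms \<open>E f * D g + D f * E g\<close> are
  symmetric in D and E and cancel in the commutator, which is why the bracket is again a
  derivation.\<close>

lemma derivation_L_mult: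
  assumes D: "D \<in> T" and E: "E \<in> T" and f: "smooth_near M \<one> f" and g: "smooth_near M \<one> g"
  shows "D (L E (\<lambda>x. f x * g x)) =
    D (L E f) * g \<one> + E f * D g + D f * E g + f \<one> * D (L E g)"
proof -
  note Lf = smooth_near_L[OF E f] and Lg = smooth_near_L[OF E g]
  note fg = smooth_near_add_mult(2)[OF atlas Lf g] smooth_near_add_mult(2)[OF atlas f Lg]
  have "D (L E (\<lambda>x. f x * g x)) = D (\<lambda>x. L E f x * g x + f x * L E g x)"
    by (rule derivation_cong_eventually[OF D atlas smooth_near_add_mult(1)[OF atlas fg] L_mult[OF E f g], symmetric])
  also have "\<dots> = D (\<lambda>x. L E f x * g x) + D (\<lambda>x. f x * L E g x)"
    by (rule tangent_spaceD(3)[OF D fg])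
  finally show ?thesis
    by (simp add: tangent_spaceD(5)[OF D Lf g] tangent_spaceD(5)[OF D f Lg] L_one[OF E] f g)
qed

lemma derivation_L_cong:
  assumes D: "D \<in> T" and E: "E \<in> T" and f: "smooth_near M \<one> f"
    and fg: "\<forall>\<^sub>F x in nhdsin (mtop M) \<one>. f x = g x"
  shows "D (L E f) = D (L E g)"
  by (rule derivation_cong_eventually[OF D atlas smooth_near_L[OF E f] L_cong[OF E f fg]])

lemma lie_bracket_closed:
  assumes D: "D \<in> T" and E: "E \<in> T"
  shows "lie_bracket G M D E \<in> T"
  unfolding tangent_space_def
proof (intro CollectI conjI allI impI)
  fix f g and c :: real
  show "lie_bracket G M D E f = 0" if "\<not> smooth_near M \<one> f"
    using that by (rule lie_bracket_nonsmooth)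
  assume f: "smooth_near M \<one> f"
  note [simp] = lie_bracket_eq[OF D E]
  show "lie_bracket G M D E (\<lambda>x. c * f x) = c * lie_bracket G M D E f"
    by (simp add: f smooth_near_cmult[OF atlas] derivation_L_cmult D E algebra_simps)
  assume g: "smooth_near M \<one> g"
  show "lie_bracket G M D E (\<lambda>x. f x + g x) = lie_bracket G M D E f + lie_bracket G M D E g"
    by (simp add: f g smooth_near_add_mult[OF atlas] derivation_L_add D E algebra_simps)
  show "lie_bracket G M D E (\<lambda>x. f x * g x) = lie_bracket G M D E f * g \<one> + f \<one> * lie_bracket G M D E g"
    by (simp add: f g smooth_near_add_mult[OF atlas] derivation_L_mult D E algebra_simps)
  assume "same_germ M \<one> f g"
  then have "\<forall>\<^sub>F x in nhdsin (mtop M) \<one>. f x = g x"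
    unfolding same_germ_def eventually_nhdsin by blast
  then show "lie_bracket G M D E f = lie_bracket G M D E g"
    by (simp add: f g derivation_L_cong[OF _ _ f] D E)
qed

text \<open>The double bracket as convolution words: XYZ - XZY - YZX + ZYX. \<open>L_L\<close> turns
  the field of the inner bracket into a difference of iterated fields.\<close>

lemma lie_bracket_lie_bracket:
  assumes X: "X \<in> T" and Y: "Y \<in> T" and Z: "Z \<in> T" and f: "smooth_near M \<one> f"
  shows "lie_bracket G M X (lie_bracket G M Y Z) f =
    X (L Y (L Z f)) - X (L Z (L Y f)) - Y (L Z (L X f)) + Z (L Y (L X f))"
proof -
  let ?B = "lie_bracket G M Y Z"
  note LL = smooth_near_L[OF Y smooth_near_L[OF Z f]] smooth_near_L[OF Z smooth_near_L[OF Y f]]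
  have "\<forall>\<^sub>F x in nhdsin (mtop M) \<one>. L Y (L Z f) x - L Z (L Y f) x = L ?B f x"
    using smooth_near_eventually[OF f]
  proof eventually_elim
    fix x assume x: "smooth_near M x f"
    show "L Y (L Z f) x - L Z (L Y f) x = L ?B f x"
      using lie_bracket_eq[OF Y Z smooth_near_translate[OF x]] L_L[OF Y Z x] L_L[OF Z Y x]
      by (simp add: L_def[of ?B])
  qed
  then have "X (\<lambda>x. L Y (L Z f) x - L Z (L Y f) x) = X (L ?B f)"
    by (rule derivation_cong_eventually[OF X atlas smooth_near_diff[OF atlas LL]])
  then show ?thesis
    using derivation_diff[OF X atlas LL] lie_bracket_eq[OF X lie_bracket_closed[OF Y Z] f]
      lie_bracket_eq[OF Y Z smooth_near_L[OF X f]] by simp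
qed

section \<open>Vector space structure, bilinearity and the Jacobi identity\<close>

lemma tangent_space_add: "D \<in> T \<Longrightarrow> E \<in> T \<Longrightarrow> (\<lambda>f. D f + E f) \<in> T"
  unfolding tangent_space_def by (simp add: algebra_simps)

lemma tangent_space_scale: "D \<in> T \<Longrightarrow> (\<lambda>f. c * D f) \<in> T"
  unfolding tangent_space_def by (simp add: algebra_simps)

text \<open>\<open>L\<close> is additive in the derivation at every point by its definition. In the
  field argument it remains to use additivity of F on the smooth functions \<open>L D f\<close> and
  \<open>L E f\<close>.\<close>

lemma lie_bracket_add:
  assumes D: "D \<in> T" and E: "E \<in> T" and F: "F \<in> T"
  shows "lie_bracket G M (\<lambda>f. D f + E f) F = (\<lambda>f. lie_bracket G M D F f + lie_bracket G M E F f)"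
    and "lie_bracket G M F (\<lambda>f. D f + E f) = (\<lambda>f. lie_bracket G M F D f + lie_bracket G M F E f)"
proof -
  have L: "L (\<lambda>f. D f + E f) f = (\<lambda>x. L D f x + L E f x)" for f
    by (simp add: L_def[abs_def])
  have F_add: "F (\<lambda>x. L D f x + L E f x) = F (L D f) + F (L E f)" if "smooth_near M \<one> f" for f
    using that by (intro tangent_spaceD(3)[OF F] smooth_near_L D E)
  note DE = tangent_space_add[OF D E]
  show "lie_bracket G M (\<lambda>f. D f + E f) F = (\<lambda>f. lie_bracket G M D F f + lie_bracket G M E F f)"
  proof
    fix f
    show "lie_bracket G M (\<lambda>f. D f + E f) F f = lie_bracket G M D F f + lie_bracket G M E F f"
      by (cases "smooth_near M \<one> f")
        (simp_all add: lie_bracket_eq[OF DE F] lie_bracket_eq[OF D F] lie_bracket_eq[OF E F] lie_bracket_nonsmooth L F_add)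
  qed
  show "lie_bracket G M F (\<lambda>f. D f + E f) = (\<lambda>f. lie_bracket G M F D f + lie_bracket G M F E f)"
  proof
    fix f
    show "lie_bracket G M F (\<lambda>f. D f + E f) f = lie_bracket G M F D f + lie_bracket G M F E f"
      by (cases "smooth_near M \<one> f")
        (simp_all add: lie_bracket_eq[OF F DE] lie_bracket_eq[OF F D] lie_bracket_eq[OF F E] lie_bracket_nonsmooth L F_add)
  qed
qed

lemma lie_bracket_scale:
  assumes D: "D \<in> T" and F: "F \<in> T"
  shows "lie_bracket G M (\<lambda>f. c * D f) F = (\<lambda>f. c * lie_bracket G M D F f)"
    and "lie_bracket G M F (\<lambda>f. c * D f) = (\<lambda>f. c * lie_bracket G M F D f)"
proof -
  have L: "L (\<lambda>f. c * D f) f = (\<lambda>x. c * L D f x)" for f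
    by (simp add: L_def[abs_def])
  have F_cmult: "F (\<lambda>x. c * L D f x) = c * F (L D f)" if "smooth_near M \<one> f" for f
    using that by (intro tangent_spaceD(4)[OF F] smooth_near_L D)
  note cD = tangent_space_scale[OF D, of c]
  show "lie_bracket G M (\<lambda>f. c * D f) F = (\<lambda>f. c * lie_bracket G M D F f)"
  proof
    fix f
    show "lie_bracket G M (\<lambda>f. c * D f) F f = c * lie_bracket G M D F f"
      by (cases "smooth_near M \<one> f")
        (simp_all add: lie_bracket_eq[OF cD F] lie_bracket_eq[OF D F] lie_bracket_nonsmooth L F_cmult right_diff_distrib)
  qed
  show "lie_bracket G M F (\<lambda>f. c * D f) = (\<lambda>f. c * lie_bracket G M F D f)"
  proof
    fix f
    show "lie_bracket G M F (\<lambda>f. c * D f) f = c * lie_bracket G M F D f"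
      by (cases "smooth_near M \<one> f")
        (simp_all add: lie_bracket_eq[OF F cD] lie_bracket_eq[OF F D] lie_bracket_nonsmooth L F_cmult right_diff_distrib)
  qed
qed

text \<open>The twelve terms are the six words in X, Y, Z, each with both signs.\<close>

lemma lie_bracket_jacobi:
  assumes X: "X \<in> T" and Y: "Y \<in> T" and Z: "Z \<in> T"
  shows "lie_bracket G M X (lie_bracket G M Y Z) f + lie_bracket G M Y (lie_bracket G M Z X) f
    + lie_bracket G M Z (lie_bracket G M X Y) f = 0"
  by (cases "smooth_near M \<one> f")
    (simp_all add: lie_bracket_lie_bracket[OF X Y Z] lie_bracket_lie_bracket[OF Y Z X]
      lie_bracket_lie_bracket[OF Z X Y] lie_bracket_nonsmooth)

lemma field_real_field: "Ring.field real_field"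
proof -
  have "abelian_group real_field"
    by (rule abelian_groupI) (auto simp: real_field_def intro: exI[of _ "- x" for x])
  moreover have "Group.comm_monoid real_field"
    by (rule comm_monoidI) (auto simp: real_field_def)
  ultimately have "cring real_field"
    by (rule cringI) (auto simp: real_field_def algebra_simps)
  then show ?thesis
  proof (rule cring.cring_fieldI2)
    show "\<exists>b\<in>carrier real_field. a \<otimes>\<^bsub>real_field\<^esub> b = \<one>\<^bsub>real_field\<^esub>"
      if "a \<noteq> \<zero>\<^bsub>real_field\<^esub>" for a
      using that by (intro bexI[of _ "inverse a"]) (auto simp: real_field_def)
  qed (simp add: real_field_def)
qed

lemma module_lie_algebra_of: "Module.module real_field (lie_algebra_of G M)"
proof (rule moduleI)
  show "cring real_field" using field_real_field by (simp add: field_def domain_def)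
  have "(\<lambda>f. 0) \<in> T" unfolding tangent_space_def by simp
  moreover have "\<exists>E\<in>T. (\<lambda>f. E f + D f) = (\<lambda>f. 0)" if "D \<in> T" for D
    using tangent_space_scale[OF that, of "- 1"] by (intro bexI[of _ "\<lambda>f. - 1 * D f"]) auto
  ultimately show "abelian_group (lie_algebra_of G M)"
    by (intro abelian_groupI) (auto simp: lie_algebra_of_def tangent_space_add add.assoc add.commute)
qed (auto simp: lie_algebra_of_def real_field_def tangent_space_scale algebra_simps)

lemma lie_algebra_lie_algebra_of: "lie_algebra real_field (lie_algebra_of G M)"
proof (rule lie_algebra.intro[OF field_real_field module_lie_algebra_of], unfold_locales)
  have "lie_bracket G M X X f = 0" if "X \<in> T" for X f
    by (cases "smooth_near M \<one> f") (simp_all add: lie_bracket_eq that lie_bracket_nonsmooth)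
  then show "x \<otimes>\<^bsub>lie_algebra_of G M\<^esub> x = \<zero>\<^bsub>lie_algebra_of G M\<^esub>" if "x \<in> carrier (lie_algebra_of G M)" for x
    using that by (auto simp: lie_algebra_of_def)
qed (auto simp: lie_algebra_of_def lie_bracket_closed lie_bracket_add lie_bracket_scale lie_bracket_jacobi)

subsection \<open>Averaging operators\<close>

text \<open>
  The bracket is the second derivative of conjugation: apply \<open>D\<close> to both sides of
  \<open>u k = (u k u\<^sup>-\<^sup>1) u\<close> as functions of \<open>u\<close>, use the product rule on the right, and then apply \<open>E\<close> in \<open>k\<close>.
\<close>

lemma lie_bracket_conj:
  assumes D: "D \<in> T" and E: "E \<in> T" and f: "smooth_near M \<one> f"
  shows "lie_bracket G M D E f = D (\<lambda>u. E (\<lambda>k. f (u \<otimes> k \<otimes> inv u)))"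
proof -
  note MM = smooth_atlas_prod[OF atlas atlas]
  have conj: "smooth_at (prod_manifold M M) M (\<one>, \<one>) (\<lambda>z. fst z \<otimes> snd z \<otimes> inv (fst z))"
    by (intro smooth_at_mult smooth_at_inv MM smooth_at_fst smooth_at_snd atlas) (auto simp: topspace)
  have fconj: "smooth_near (prod_manifold M M) (\<one>, \<one>) (\<lambda>z. f (fst z \<otimes> snd z \<otimes> inv (fst z)))"
    using smooth_atD[OF conj, of f] f by simp
  let ?A = "\<lambda>k. D (\<lambda>u. f (u \<otimes> k \<otimes> inv u))"
  have A: "smooth_near M \<one> ?A"
    using smooth_near_partial_derivation[OF atlas atlas smooth_near_swap[OF atlas atlas fconj] D] by simp
  have "\<forall>\<^sub>F k in nhdsin (mtop M) \<one>. ?A k + L D f k = D (\<lambda>u. f (u \<otimes> k))"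
    using smooth_near_eventually[OF f]
  proof eventually_elim
    fix k assume fk: "smooth_near M k f"
    then have k: "k \<in> carrier G" by (rule smooth_near_carrier)
    \<comment> \<open>\<open>?\<Psi>\<close> looks at f around k, since (1, 1) is sent to k. The
      equation is therefore proved for those k near which f is smooth, and this germ in k is all
      that E sees.\<close>
    let ?\<Psi> = "\<lambda>z. f (fst z \<otimes> k \<otimes> inv (fst z) \<otimes> snd z)"
    have "smooth_at (prod_manifold M M) M (\<one>, \<one>) (\<lambda>z. fst z \<otimes> k \<otimes> inv (fst z) \<otimes> snd z)"
      using k by (intro smooth_at_mult smooth_at_inv MM smooth_at_fst smooth_at_snd smooth_at_const atlas)
        (auto simp: topspace)
    from smooth_atD[OF this, of f] fk k
    have \<Psi>: "smooth_near (prod_manifold M M) (\<one>, \<one>) ?\<Psi>" by simp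
    have \<Psi>d: "smooth_near M \<one> (\<lambda>u. ?\<Psi> (u, u))"
      by (rule smooth_atD[OF smooth_at_Pair[OF atlas atlas atlas smooth_at_ident smooth_at_ident] \<Psi>])
    have "D (\<lambda>u. ?\<Psi> (u, u)) = D (\<lambda>u. f (u \<otimes> k))"
      by (rule derivation_cong[OF D atlas \<Psi>d openin_topspace one_topspace])
        (simp add: topspace k m_assoc)
    moreover have "D (\<lambda>u. ?\<Psi> (u, \<one>)) = ?A k"
      by (rule derivation_cong[OF D atlas smooth_near_slice(1)[OF atlas atlas \<Psi>] openin_topspace one_topspace])
        (simp add: topspace k)
    moreover have "D (\<lambda>w. ?\<Psi> (\<one>, w)) = L D f k"
      by (simp add: L_def k)
    ultimately show "?A k + L D f k = D (\<lambda>u. f (u \<otimes> k))"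
      using derivation_diagonal[OF atlas \<Psi> D] by simp
  qed
  from derivation_cong_eventually[OF E atlas smooth_near_add_mult(1)[OF atlas A smooth_near_L[OF D f]] this]
  have "E ?A + E (L D f) = E (\<lambda>k. D (\<lambda>u. f (u \<otimes> k)))"
    using tangent_spaceD(3)[OF E A smooth_near_L[OF D f]] by simp
  also have "\<dots> = D (L E f)"
    using derivations_commute[OF atlas atlas smooth_near_mult[OF f] D E] by (simp add: L_def[abs_def])
  finally show ?thesis
    using derivations_commute[OF atlas atlas fconj D E] lie_bracket_eq[OF D E f] by simp
qed

text \<open>\<open>differential\<close> returns 0 on functions that are not smooth, so this is
  required before it can be unfolded on such an inner derivative.\<close>

lemma smooth_near_conj:
  assumes E: "E \<in> T" and f: "smooth_near M \<one> f"
  shows "smooth_near M \<one> (\<lambda>u. E (\<lambda>k. f (u \<otimes> k \<otimes> inv u)))"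
proof -
  have conj: "smooth_at (prod_manifold M M) M (\<one>, \<one>) (\<lambda>z. fst z \<otimes> snd z \<otimes> inv (fst z))"
    by (intro smooth_at_mult smooth_at_inv smooth_atlas_prod smooth_at_fst smooth_at_snd atlas) (auto simp: topspace)
  have "smooth_near (prod_manifold M M) (\<one>, \<one>) (\<lambda>z. f (fst z \<otimes> snd z \<otimes> inv (fst z)))"
    using smooth_atD[OF conj, of f] f by simp
  from smooth_near_partial_derivation[OF atlas atlas this E] show ?thesis by simp
qed

text \<open>Pullback along A respects sums, products and germs; since A fixes the identity, source
  and target germs live at the same point.\<close>

lemma differential_closed:
  assumes A: "smooth_at M M \<one> A" "A \<one> = \<one>" and D: "D \<in> T"
  shows "differential M A \<one> D \<in> T"
proof -
  have [simp]: "differential M A \<one> D f = D (\<lambda>x. f (A x))" if "smooth_near M \<one> f" for f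
    using that A(2) by (simp add: differential_def o_def)
  have fA: "smooth_near M \<one> (\<lambda>x. f (A x))" if "smooth_near M \<one> f" for f
    using smooth_atD[OF A(1)] A(2) that by simp
  show ?thesis
    unfolding tangent_space_def
  proof (intro CollectI conjI allI impI)
    fix f g and c :: real
    show "differential M A \<one> D f = 0" if "\<not> smooth_near M \<one> f"
      using that A(2) by (simp add: differential_def)
    assume f: "smooth_near M \<one> f"
    show "differential M A \<one> D (\<lambda>x. c * f x) = c * differential M A \<one> D f"
      by (simp add: f fA smooth_near_cmult[OF atlas] tangent_spaceD(4)[OF D])
    assume g: "smooth_near M \<one> g"
    show "differential M A \<one> D (\<lambda>x. f x + g x) = differential M A \<one> D f + differential M A \<one> D g"
      by (simp add: f g fA smooth_near_add_mult[OF atlas] tangent_spaceD(3)[OF D])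
    show "differential M A \<one> D (\<lambda>x. f x * g x) = differential M A \<one> D f * g \<one> + f \<one> * differential M A \<one> D g"
      by (simp add: f g fA smooth_near_add_mult[OF atlas] tangent_spaceD(5)[OF D] A(2))
    assume "same_germ M \<one> f g"
    then have "\<forall>\<^sub>F x in nhdsin (mtop M) (A \<one>). f x = g x"
      unfolding same_germ_def eventually_nhdsin A(2) by blast
    from smooth_at_eventually[OF atlas atlas A(1) _ this]
    have "\<forall>\<^sub>F x in nhdsin (mtop M) \<one>. f (A x) = g (A x)" by (simp add: A(2) one_topspace)
    from derivation_cong_eventually[OF D atlas fA[OF f] this]
    show "differential M A \<one> D f = differential M A \<one> D g" by (simp add: f g)
  qed
qed

lemma linear_operator_differential:
  assumes A: "smooth_at M M \<one> A" "A \<one> = \<one>"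
  shows "linear_operator real_field (lie_algebra_of G M) (differential M A \<one>)"
proof -
  have "differential M A \<one> \<in> T \<rightarrow> T" using differential_closed[OF A] by (rule funcsetI)
  moreover have "differential M A \<one> (\<lambda>f. D f + E f) = (\<lambda>f. differential M A \<one> D f + differential M A \<one> E f)"
    and "differential M A \<one> (\<lambda>f. c * D f) = (\<lambda>f. c * differential M A \<one> D f)" for D E c
    by (rule ext, simp add: differential_def)+
  ultimately show ?thesis by (simp add: linear_operator_def lie_algebra_of_def)
qed

text \<open>With P D f = D (f o A), the chain is [P X, P Y] f = X_g Y_h f(A(g) A(h) A(g)^-1) = X_g
  Y_h f(A(A(g) h A(g)^-1)) = [P X, Y] (f o A) = P [P X, Y] f. The conjugation form of the bracket is
  used at both ends, once for f and once for f o A.\<close>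

lemma averaging_operator_differential:
  assumes A: "smooth_pointed_averaging_operator G M A"
  shows "averaging_operator real_field (lie_algebra_of G M) (differential M A \<one>)"
proof -
  let ?P = "differential M A \<one>"
  have sA: "smooth_map M M A" and A1: "A \<one> = \<one>"
    and avg: "\<And>g h. g \<in> carrier G \<Longrightarrow> h \<in> carrier G \<Longrightarrow>
      A g \<otimes> A h \<otimes> inv (A g) = A (A g \<otimes> h \<otimes> inv (A g))"
    using A by (auto simp: smooth_pointed_averaging_operator_def)
  have A_at: "smooth_at M M \<one> A"
    by (rule smooth_map_imp_smooth_at[OF atlas atlas sA one_topspace])
  \<comment> \<open>A is a function on the whole type; continuity between topological spaces
    confines it to the carrier.\<close>
  have A_carrier: "A g \<in> carrier G" if "g \<in> carrier G" for g
  proof -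
    have "A ` topspace (mtop M) \<subseteq> topspace (mtop M)"
      using sA unfolding smooth_map_def by (intro continuous_map_image_subset_topspace) (rule conjunct1)
    then show ?thesis using that unfolding topspace by blast
  qed
  have P: "?P D f = D (\<lambda>x. f (A x))" if "smooth_near M \<one> f" for D f
    using that A1 by (simp add: differential_def o_def)
  have fA: "smooth_near M \<one> (\<lambda>x. f (A x))" if "smooth_near M \<one> f" for f
    using smooth_atD[OF A_at] A1 that by simp
  note P_closed = differential_closed[OF A_at A1]
  have "lie_bracket G M (?P X) (?P Y) f = ?P (lie_bracket G M (?P X) Y) f"
    if X: "X \<in> T" and Y: "Y \<in> T" for X Y f
  proof (cases "smooth_near M \<one> f")
    case f: True
    \<comment> \<open>Conjugation by u fixes the identity, so smoothness of f there suffices for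
      every u in the group. The equations below thus hold for all g, however far \<open>A g\<close>
      is from the identity.\<close>
    have fu: "smooth_near M \<one> (\<lambda>k. f (u \<otimes> k \<otimes> inv u))" if u: "u \<in> carrier G" for u
    proof -
      have "smooth_at M M \<one> (\<lambda>k. u \<otimes> k \<otimes> inv u)"
        using u by (intro smooth_at_mult smooth_at_const smooth_at_ident atlas) (auto simp: topspace)
      from smooth_atD[OF this, of f] f u show ?thesis by simp
    qed
    have "lie_bracket G M (?P X) (?P Y) f = ?P X (\<lambda>u. ?P Y (\<lambda>k. f (u \<otimes> k \<otimes> inv u)))"
      by (rule lie_bracket_conj[OF P_closed[OF X] P_closed[OF Y] f])
    also have "\<dots> = X (\<lambda>g. ?P Y (\<lambda>k. f (A g \<otimes> k \<otimes> inv (A g))))"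
      by (rule P[OF smooth_near_conj[OF P_closed[OF Y] f]])
    also have "\<dots> = X (\<lambda>g. Y (\<lambda>h. f (A (A g \<otimes> h \<otimes> inv (A g)))))"
    proof (rule derivation_cong[OF X atlas fA[OF smooth_near_conj[OF P_closed[OF Y] f]] openin_topspace one_topspace])
      fix g assume "g \<in> topspace (mtop M)"
      then have g: "g \<in> carrier G" by (simp only: topspace)
      note fg = fu[OF A_carrier[OF g]]
      have "?P Y (\<lambda>k. f (A g \<otimes> k \<otimes> inv (A g))) = Y (\<lambda>h. f (A g \<otimes> A h \<otimes> inv (A g)))"
        by (rule P[OF fg])
      also have "\<dots> = Y (\<lambda>h. f (A (A g \<otimes> h \<otimes> inv (A g))))"
        by (rule derivation_cong[OF Y atlas fA[OF fg] openin_topspace one_topspace]) (simp add: topspace avg g)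
      finally show "?P Y (\<lambda>k. f (A g \<otimes> k \<otimes> inv (A g))) = Y (\<lambda>h. f (A (A g \<otimes> h \<otimes> inv (A g))))" .
    qed
    also have "\<dots> = ?P X (\<lambda>u. Y (\<lambda>h. f (A (u \<otimes> h \<otimes> inv u))))"
      by (rule P[OF smooth_near_conj[OF Y fA[OF f]], symmetric])
    also have "\<dots> = lie_bracket G M (?P X) Y (\<lambda>x. f (A x))"
      by (rule lie_bracket_conj[OF P_closed[OF X] Y fA[OF f], symmetric])
    also have "\<dots> = ?P (lie_bracket G M (?P X) Y) f"
      by (rule P[OF f, symmetric])
    finally show ?thesis .
  next
    \<comment> \<open>Both sides take the default value 0.\<close>
    case False
    then show ?thesis by (simp add: lie_bracket_nonsmooth differential_def A1)
  qed
  then show ?thesis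
    using linear_operator_differential[OF A_at A1]
    by (auto simp: averaging_operator_def lie_algebra_of_def)
qed

end

theorem theorem2p22:
  fixes G :: "('a, 'b) monoid_scheme"
    and M :: "('a, 'e::{real_inner,banach}) manifold"
    and A :: "'a \<Rightarrow> 'a"
  assumes "lie_group G M"
    and "smooth_pointed_averaging_operator G M A"
  shows "averaging_lie_algebra real_field (lie_algebra_of G M) (differential M A \<one>\<^bsub>G\<^esub>)"
proof -
  interpret lie_grp G M using assms(1) by unfold_locales
  show ?thesis
    unfolding averaging_lie_algebra_def
    using lie_algebra_lie_algebra_of averaging_operator_differential[OF assms(2)] by blast
qed

end
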